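(* For every fixed integer $\ell\ge1$, as $X\to\infty$, $$\mathcal M_X[Z_\ell]=\frac1{\sqrt2}\mathcal M_X[E]-\sqrt\ell\,\frac{\log\log X-\log\log 2}{\log(X/2)}+O_\ell\!\left(\frac1{\log X}\right).$$ In particular, $$\mathcal M_X[Z_\ell]-\frac1{\sqrt2}\mathcal M_X[E]=O_\ell\!\left(\frac{\log\log X}{\log X}\right).$$ Consequently, one of the two logarithmic means $\mathcal M_X[Z_\ell]$, $\mathcal M_X[E]$ has a finite limit as $X\to\infty$ if and only if the other does, and in that case $$\lim_{X\to\infty}\mathcal M_X[Z_\ell]=\frac1{\sqrt2}\lim_{X\to\infty}\mathcal M_X[E].$$
   Context: For an integer $\ell\ge1$ and $n\ge 1$ put $L_n^{(\ell)}=\frac{n(\ell(n-1)+2)}{2}$ and $h_n^{(\ell)}=L_{n+1}^{(\ell)}-L_n^{(\ell)}=1+\ell n$. For real $x$ let $\nu_\ell(x)=\frac{\sqrt{8\ell x+(\ell-2)^2}+\ell-2}{2\ell}$ and $n_x^{(\ell)}=\lceil \nu_\ell(x)\rceil$ (so with $n=n_x^{(\ell)}$ one has $L_{n-1}^{(\ell)}<x\le L_n^{(\ell)}$). For $j\ge1$ let $s_j^{(\ell)}=h_j^{(\ell)}/\log L_{j+1}^{(\ell)}$ and $\Sigma_n^{(\ell)}=\sum_{j=1}^{n-1}s_j^{(\ell)}$. For $x\ge 2$ define $$\widehat S_\ell(x)=\Sigma_{n_x^{(\ell)}}^{(\ell)}-\frac{L_{n_x^{(\ell)}}^{(\ell)}-x}{\log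 L_{n_x^{(\ell)}}^{(\ell)}},\qquad q_\ell(x)=\frac{h_{n_x^{(\ell)}-1}^{(\ell)}}{\sqrt{\ell}\,\log L_{n_x^{(\ell)}}^{(\ell)}}.$$ With $\pi(x)$ the number of primes $p\le x$ and $\operatorname{li}(x)=\mathrm{PV}\!\int_0^x\frac{dt}{\log t}$ (principal value), put $$Z_\ell(x)=\frac{\widehat S_\ell(x)-\pi(x)}{q_\ell(x)},\qquad E(x)=\frac{\log x}{\sqrt x}\bigl(\operatorname{li}(x)-\pi(x)\bigr).$$ For a locally integrable function $f$ on $[2,\infty)$ and $X>2$, the logarithmic mean is $$\mathcal M_X[f]=\frac1{\log(X/2)}\int_2^X f(x)\,\frac{dx}{x}.$$ Implied constants in $O_\ell$ may depend on $\ell$ but not on $X$. No form of the Riemann hypothesis is assumed. *)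

theory Defs
  imports "HOL-Analysis.Analysis" "HOL-Library.Landau_Symbols"
    "HOL-Computational_Algebra.Primes"
begin

definition L :: "nat \<Rightarrow> nat \<Rightarrow> real" where
  "L l n = real n * (real l * (real n - 1) + 2) / 2"

definition h :: "nat \<Rightarrow> nat \<Rightarrow> real" where
  "h l n = L l (n + 1) - L l n"

lemma h_eq: "h l n = 1 + real l * real n"
  by (simp add: h_def L_def field_simps)

definition \<nu> :: "nat \<Rightarrow> real \<Rightarrow> real" where
  "\<nu> l x = (sqrt (8 * real l * x + (real l - 2)\<^sup>2) + real l - 2) / (2 * real l)"

text \<open>The truncation by \<open>nat\<close> is harmless where the index is used, namely for
  \<open>x \<ge> 2\<close>: see \<open>L_bracket\<close> below.\<close>

definition nidx :: "nat \<Rightarrow> real \<Rightarrow> nat" where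
  "nidx l x = nat \<lceil>\<nu> l x\<rceil>"

definition s :: "nat \<Rightarrow> nat \<Rightarrow> real" where
  "s l j = h l j / ln (L l (j + 1))"

definition \<Sigma>s :: "nat \<Rightarrow> nat \<Rightarrow> real" where
  "\<Sigma>s l n = (\<Sum>j = 1..n - 1. s l j)"

definition S_hat :: "nat \<Rightarrow> real \<Rightarrow> real" where
  "S_hat l x = \<Sigma>s l (nidx l x) - (L l (nidx l x) - x) / ln (L l (nidx l x))"

definition q :: "nat \<Rightarrow> real \<Rightarrow> real" where
  "q l x = h l (nidx l x - 1) / (sqrt (real l) * ln (L l (nidx l x)))"

definition prime_pi :: "real \<Rightarrow> real" where
  "prime_pi x = real (card {p :: nat. prime p \<and> real p \<le> x})"

text \<open>The principal value excises the symmetric neighbourhood \<open>(1 - \<epsilon>, 1 + \<epsilon>)\<close> of the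
  singularity at 1; the definition is meaningful for \<open>x > 1\<close>.\<close>

definition li :: "real \<Rightarrow> real" where
  "li x = Lim (at_right 0)
     (\<lambda>\<epsilon>. integral {0..1 - \<epsilon>} (\<lambda>t. 1 / ln t) + integral {1 + \<epsilon>..x} (\<lambda>t. 1 / ln t))"

definition Z :: "nat \<Rightarrow> real \<Rightarrow> real" where
  "Z l x = (S_hat l x - prime_pi x) / q l x"

definition E :: "real \<Rightarrow> real" where
  "E x = ln x / sqrt x * (li x - prime_pi x)"

definition log_mean :: "(real \<Rightarrow> real) \<Rightarrow> real \<Rightarrow> real" where
  "log_mean f X = 1 / ln (X / 2) * integral {2..X} (\<lambda>x. f x / x)"

lemma L_\<nu>_le:
  fixes t :: real
  assumes "l \<ge> 1" "x \<ge> 2" "t \<ge> 1"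
  shows "x \<le> t * (real l * (t - 1) + 2) / 2 \<longleftrightarrow> \<nu> l x \<le> t"
proof -
  let ?a = "2 * real l * t - (real l - 2)"
  have "real l * t \<ge> real l * 1" using assms by (intro mult_left_mono) auto
  then have a: "?a \<ge> 0" using assms by linarith
  have "\<nu> l x \<le> t \<longleftrightarrow> sqrt (8 * real l * x + (real l - 2)\<^sup>2) \<le> ?a"
    using assms by (simp add: \<nu>_def field_simps)
  also have "\<dots> \<longleftrightarrow> 8 * real l * x + (real l - 2)\<^sup>2 \<le> ?a\<^sup>2"
    using a by (metis real_sqrt_le_iff real_sqrt_abs abs_of_nonneg)
  also have "?a\<^sup>2 = 8 * real l * (t * (real l * (t - 1) + 2) / 2) + (real l - 2)\<^sup>2"
    by (simp add: power2_eq_square field_simps)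
  finally show ?thesis using assms by (simp add: mult.commute)
qed

lemma L_bracket:
  assumes "l \<ge> 1" "x \<ge> 2"
  shows "nidx l x \<ge> 2" "L l (nidx l x - 1) < x" "x \<le> L l (nidx l x)"
proof -
  have "\<not> \<nu> l x \<le> 1" using L_\<nu>_le[of l x 1] assms by simp
  then have c: "\<lceil>\<nu> l x\<rceil> \<ge> 2" by linarith
  then show n: "nidx l x \<ge> 2" unfolding nidx_def by linarith
  have r: "real (nidx l x) = of_int \<lceil>\<nu> l x\<rceil>" using c by (simp add: nidx_def)
  have "\<nu> l x \<le> real (nidx l x)" "\<not> \<nu> l x \<le> real (nidx l x - 1)"
    using n r by (auto simp: of_nat_diff) linarith+
  then show "L l (nidx l x - 1) < x" "x \<le> L l (nidx l x)"
    using L_\<nu>_le[of l x "real (nidx l x)"] L_\<nu>_le[of l x "real (nidx l x - 1)"] assms n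
    by (auto simp: L_def)
qed

end

theory Submission
  imports Defs "HOL-Number_Theory.Prime_Powers" "HOL-Real_Asymp.Real_Asymp"
begin

text \<open>Write \<open>Z l x / x - E x / (\<surd>2 x)\<close> as
  \<open>(S_hat - li) / (q x) + (li - \<pi>) w\<close> with \<open>w = (1/q - ln x / \<surd>(2x)) / x\<close>.
  The first summand is an Euler-Maclaurin error: on each interval between consecutive partition
  points the right-endpoint rule loses half a step, which accounts for
  \<open>S_hat - li = - \<surd>(2 l x) / (ln x)\<^sup>2 + O(\<surd>x / (ln x)^3)\<close> and hence for the term
  \<open>- \<surd>l ln ln X\<close>. For the second summand no prime number theorem is needed, since
  \<open>w = \<surd>l / (2 x\<^sup>2) + K' + O(ln x / x^(5/2))\<close>, where \<open>K = O(x^(-5/4))\<close> is continuous and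
  piecewise smooth: the integral of \<open>(li - \<pi>) / x\<^sup>2\<close> is bounded by Mertens' second theorem, the
  one of \<open>(li - \<pi>) K'\<close> by partial summation, and the remainder by \<open>li - \<pi> = O(x)\<close>.\<close>

subsection \<open>Mertens' first theorem\<close>

text \<open>The obstacle is that w has size ln x / x^2. Against li - pi = O(x) its integral could
  grow like (ln X)^2, and a bound O(x / ln x) would still leave ln X, whereas only O(1) is
  affordable before the division by ln(X / 2). So the leading part of w has to be known exactly. The
  square of an interval length is affine in the midpoint of the interval. Hence 1 / gap deviates
  from 1 / sqrt(2 l x) to first order by a multiple of the signed distance to the midpoint, which
  has mean zero on each interval; this is why K is O(ln x / x^(3/2)) and not merely O(ln x / x). The
  smooth part sqrt l / (2 x^2) appears because the logarithm in q is taken at the right endpoint, on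
  average half a step above x. It carries no logarithm, and so Mertens' theorem suffices for it. In
  the first summand, half a step sqrt(2 l x) / 2 times the derivative -1 / (x (ln x)^2) of 1 / ln x
  integrates to about - sqrt(2 l x) / (ln x)^2; multiplied by 1 / (q x), about ln x / (sqrt 2
  x^(3/2)), it becomes - sqrt l / (x ln x).\<close>

lemma prod_pairwise_coprime_dvd:
  fixes A :: "nat set"
  assumes "finite A" "\<And>a. a \<in> A \<Longrightarrow> a dvd m"
    "\<And>a b. a \<in> A \<Longrightarrow> b \<in> A \<Longrightarrow> a \<noteq> b \<Longrightarrow> coprime a b"
  shows "\<Prod>A dvd m"
  using assms
proof (induction A rule: finite_induct)
  case (insert a A)
  have "coprime a (\<Prod>A)" using insert by (intro prod_coprime_right) auto
  then have "a * \<Prod>A dvd m" using insert by (intro divides_mult) auto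
  then show ?case using insert by simp
qed simp

text \<open>Such a prime divides the numerator (2m+1)! of the binomial coefficient, but neither
  factor of the denominator m! (m+1)!.\<close>

lemma prod_primes_choose_dvd:
  "\<Prod>{p. prime p \<and> m + 1 < p \<and> p \<le> 2 * m + 1} dvd ((2 * m + 1) choose m)"
proof (rule prod_pairwise_coprime_dvd)
  fix p assume "p \<in> {p. prime p \<and> m + 1 < p \<and> p \<le> 2 * m + 1}"
  then have p: "prime p" "m + 1 < p" "p \<le> 2 * m + 1" by auto
  have "fact m * fact (m + 1) * ((2 * m + 1) choose m) = (fact (2 * m + 1) :: nat)"
    using binomial_fact_lemma[of m "2 * m + 1"] by simp
  moreover have "p dvd fact (2 * m + 1)" "\<not> p dvd fact m" "\<not> p dvd fact (m + 1)"
    using p by (auto simp: prime_dvd_fact_iff simp del: fact_Suc)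
  ultimately show "p dvd ((2 * m + 1) choose m)"
    using p(1) by (metis prime_dvd_multD)
next
  fix a b assume "a \<in> {p. prime p \<and> m + 1 < p \<and> p \<le> 2 * m + 1}" "b \<in> {p. prime p \<and> m + 1 < p \<and> p \<le> 2 * m + 1}" "a \<noteq> b"
  then show "coprime a b" by (auto intro: primes_coprime)
qed auto

text \<open>Row 2m+1 of Pascal's triangle has two equal central entries, and its sum is 2 *
  4^m.\<close>

lemma choose_odd_le: "((2 * m + 1) choose m) \<le> 4 ^ m"
proof -
  have "2 * ((2 * m + 1) choose m) = ((2 * m + 1) choose m) + ((2 * m + 1) choose (m + 1))"
    using binomial_symmetric[of m "2 * m + 1"] by simp
  also have "\<dots> = (\<Sum>k\<in>{m, m + 1}. (2 * m + 1) choose k)" by simp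
  also have "\<dots> \<le> (\<Sum>k\<le>2 * m + 1. (2 * m + 1) choose k)" by (intro sum_mono2) auto
  also have "\<dots> = 2 * 4 ^ m" unfolding choose_row_sum by (simp add: power_mult)
  finally show ?thesis by simp
qed

text \<open>Erdos' induction: an even n > 2 is composite and reduces to n - 1; for n = 2m+1 the
  primes up to m+1 are covered by induction and the others divide a central binomial
  coefficient.\<close>

lemma primorial_le: "\<Prod>{p. prime p \<and> p \<le> n} \<le> (4::nat) ^ n"
proof (induction n rule: less_induct)
  case (less n)
  consider "n \<le> 2" | m where "n > 2" "n = 2 * m + 1" | "n > 2" "even n"
    by (meson leI oddE)
  then show ?case
  proof cases
    case 1
    then have "{p::nat. prime p \<and> p \<le> n} = (if n = 2 then {2} else {})"
      by (auto dest: prime_ge_2_nat)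
    then show ?thesis by simp
  next
    case 2
    have "{p. prime p \<and> p \<le> n} = {p. prime p \<and> p \<le> m + 1} \<union> {p. prime p \<and> m + 1 < p \<and> p \<le> 2 * m + 1}"
      using 2 by auto
    then have "\<Prod>{p. prime p \<and> p \<le> n} =
        \<Prod>{p. prime p \<and> p \<le> m + 1} * \<Prod>{p. prime p \<and> m + 1 < p \<and> p \<le> 2 * m + 1}"
      by (simp, subst prod.union_disjoint) auto
    also have "\<dots> \<le> 4 ^ (m + 1) * 4 ^ m"
    proof (intro mult_mono)
      show "\<Prod>{p. prime p \<and> p \<le> m + 1} \<le> 4 ^ (m + 1)"
        using less[of "m + 1"] 2 by linarith
      show "\<Prod>{p. prime p \<and> m + 1 < p \<and> p \<le> 2 * m + 1} \<le> 4 ^ m"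
        using dvd_imp_le[OF prod_primes_choose_dvd[of m]] choose_odd_le[of m] by (simp add: zero_less_binomial)
    qed auto
    also have "\<dots> = 4 ^ n" using 2 by (simp add: power_add[symmetric])
    finally show ?thesis .
  next
    case 3
    then have np: "\<not> prime n" using prime_odd_nat by auto
    have "{p. prime p \<and> p \<le> n} = {p. prime p \<and> p \<le> n - 1}"
    proof (intro Collect_cong conj_cong refl)
      fix p :: nat assume "prime p"
      then have "p \<noteq> n" using np by auto
      then show "(p \<le> n) = (p \<le> n - 1)" by auto
    qed
    then have "\<Prod>{p. prime p \<and> p \<le> n} \<le> 4 ^ (n - 1)" using less 3 by simp
    also have "\<dots> \<le> 4 ^ n" by (intro power_increasing) auto
    finally show ?thesis .
  qed
qed

lemma sum_ln_primes_le: "(\<Sum>p | prime p \<and> p \<le> n. ln (real p)) \<le> real n * ln 4"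
proof -
  have "(\<Sum>p | prime p \<and> p \<le> n. ln (real p)) = ln (real (\<Prod>{p. prime p \<and> p \<le> n}))"
    by (simp, subst ln_prod) (auto dest: prime_gt_0_nat)
  also have "\<dots> \<le> ln (real (4 ^ n))"
    using primorial_le[of n] by (subst ln_le_cancel_iff)
      (auto simp: prime_gt_0_nat simp del: of_nat_prod of_nat_power intro!: prod_pos)
  finally show ?thesis by (simp add: ln_realpow)
qed

text \<open>Legendre's formula: each ln m is the sum of the Mangoldt function over the divisors of
  m, and d has n div d multiples up to n.\<close>

lemma ln_fact_mangoldt: "ln (fact n) = (\<Sum>d = 1..n. mangoldt d * real (n div d))"
proof -
  have "ln (fact n :: real) = (\<Sum>m = 1..n. ln (real m))"
    by (simp add: fact_prod, subst ln_prod) auto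
  also have "\<dots> = (\<Sum>m = 1..n. \<Sum>d | d \<in> {1..n} \<and> d dvd m. mangoldt d)"
  proof (intro sum.cong refl)
    fix m assume m: "m \<in> {1..n}"
    then have "{d. d \<in> {1..n} \<and> d dvd m} = {d. d dvd m}"
      using dvd_imp_le[of _ m] by (auto intro!: Nat.gr0I simp: Suc_le_eq) fastforce+
    then show "ln (real m) = (\<Sum>d | d \<in> {1..n} \<and> d dvd m. mangoldt d)"
      using m mangoldt_sum[of m, where ?'a = real] by simp
  qed
  also have "\<dots> = (\<Sum>d = 1..n. \<Sum>m | m \<in> {1..n} \<and> d dvd m. mangoldt d)"
    by (rule sum.swap_restrict) auto
  also have "\<dots> = (\<Sum>d = 1..n. mangoldt d * real (n div d))"
  proof (intro sum.cong refl)
    fix d assume d: "d \<in> {1..n}"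
    have "{m. m \<in> {1..n} \<and> d dvd m} = (\<lambda>k. d * k) ` {1..n div d}"
      using d by (auto simp: image_iff dvd_def less_eq_div_iff_mult_less_eq mult.commute
          intro!: bexI)
    then have "card {m. m \<in> {1..n} \<and> d dvd m} = n div d"
      using d by (simp add: card_image inj_on_def)
    then show "(\<Sum>m | m \<in> {1..n} \<and> d dvd m. mangoldt d) = mangoldt d * real (n div d)"
      by (simp add: mult.commute)
  qed
  finally show ?thesis .
qed

lemma ln_fact_ge: "real n * ln (real n) - real n \<le> ln (fact n)"
proof (induction n)
  case (Suc n)
  have "real n * (ln (real (Suc n)) - ln (real n)) \<le> 1"
  proof (cases "n = 0")
    case False
    then have "ln (real (Suc n)) - ln (real n) = ln (1 + 1 / real n)"
      by (subst ln_divide_pos[symmetric]) (auto simp: add_divide_distrib add.commute)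
    also have "\<dots> \<le> 1 / real n" by (rule ln_add_one_self_le_self) auto
    finally show ?thesis using False by (simp add: field_simps)
  qed auto
  moreover have "ln (fact (Suc n) :: real) = ln (real (Suc n)) + ln (fact n)"
    by (simp add: ln_mult)
  ultimately show ?case using Suc by (simp add: algebra_simps)
qed simp

lemma ln_fact_le: "ln (fact n) \<le> real n * ln (real n)"
proof (cases "n = 0")
  case False
  have "ln (fact n :: real) \<le> ln (real (n ^ n))"
    using fact_le_power[of n, where ?'a = real] False by (subst ln_le_cancel_iff) auto
  then show ?thesis using False by (simp add: ln_realpow)
qed simp

text \<open>Only the powers p^k with k at least 2 contribute. For fixed p they form a geometric
  series bounded by 2 ln p / p^2, which is summable over p.\<close>

lemma sum_mangoldt_nonprime_bounded:
  "\<exists>C. \<forall>n. (\<Sum>d | d \<in> {1..n} \<and> \<not> prime d. mangoldt d / real d) \<le> C"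
proof -
  have "summable (\<lambda>p. 2 * ln (real p) / real p ^ 2)"
  proof (rule summable_comparison_test_bigo)
    \<comment> \<open>Any exponent strictly between -2 and -1 would do: it absorbs the logarithm and
      stays summable.\<close>
    show "summable (\<lambda>n. norm (real n powr (-3/2)))" by (simp add: summable_real_powr_iff)
    show "(\<lambda>p. 2 * ln (real p) / real p ^ 2) \<in> O(\<lambda>n. real n powr (-3/2))" by real_asymp
  qed
  then have bd: "(\<Sum>p\<in>{2..n}. 2 * ln (real p) / real p ^ 2) \<le> suminf (\<lambda>p. 2 * ln (real p) / real p ^ 2)" for n
  proof (intro sum_le_suminf)
    show "0 \<le> 2 * ln (real p) / real p ^ 2" for p by (cases p) auto
  qed auto
  have "(\<Sum>d | d \<in> {1..n} \<and> \<not> prime d. mangoldt d / real d) \<le> (\<Sum>p\<in>{2..n}. 2 * ln (real p) / real p ^ 2)" for n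
  proof -
    let ?I = "{p\<in>{2..n}. prime p} \<times> {2..n}"
    let ?f = "\<lambda>(p, k). p ^ k :: nat"
    have sub: "{d. d \<in> {1..n} \<and> \<not> prime d \<and> primepow d} \<subseteq> ?f ` ?I"
    proof
      fix d assume "d \<in> {d. d \<in> {1..n} \<and> \<not> prime d \<and> primepow d}"
      then have d: "d \<le> n" "\<not> prime d" "primepow d" by auto
      then obtain p k where pk: "prime p" "k > 0" "d = p ^ k" unfolding primepow_def by auto
      have "k \<noteq> 1" using pk d by auto
      moreover have "k < p ^ k"
        using power_mono[of 2 p k] prime_ge_2_nat[OF pk(1)] less_exp[of k] by linarith
      moreover have "p ^ 1 \<le> p ^ k" using pk prime_gt_0_nat[OF pk(1)] by (intro power_increasing) auto
      ultimately have "(p, k) \<in> ?I" using pk d prime_ge_2_nat[OF pk(1)] by auto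
      then show "d \<in> ?f ` ?I" using pk by force
    qed
    have "(\<Sum>d | d \<in> {1..n} \<and> \<not> prime d. mangoldt d / real d) =
          (\<Sum>d | d \<in> {1..n} \<and> \<not> prime d \<and> primepow d. mangoldt d / real d)"
      by (rule sum.mono_neutral_right) (auto simp: mangoldt_def)
    also have "\<dots> \<le> (\<Sum>d\<in>?f ` ?I. mangoldt d / real d)"
      using sub by (intro sum_mono2) (auto simp: mangoldt_nonneg)
    also have "\<dots> \<le> (\<Sum>i\<in>?I. ((\<lambda>d. mangoldt d / real d) \<circ> ?f) i)"
      by (intro sum_image_le) (auto simp: mangoldt_nonneg)
    also have "\<dots> = (\<Sum>p | p \<in> {2..n} \<and> prime p. \<Sum>k = 2..n. ln (real p) / real p ^ k)"
      by (auto simp: sum.cartesian_product intro!: sum.cong)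
    also have "\<dots> \<le> (\<Sum>p | p \<in> {2..n} \<and> prime p. 2 * ln (real p) / real p ^ 2)"
    proof (intro sum_mono)
      fix p assume "p \<in> {p. p \<in> {2..n} \<and> prime p}"
      then have p: "p \<ge> 2" by auto
      have "(\<Sum>k = 2..n. ln (real p) / real p ^ k) \<le> (\<Sum>k\<in>{2..<n+2}. ln (real p) / real p ^ k)"
        using p by (intro sum_mono2) auto
      also have "\<dots> = (\<Sum>k<n. ln (real p) / real p ^ (k + 2))"
        using sum.shift_bounds_nat_ivl[of "\<lambda>k. ln (real p) / real p ^ k" 0 2 n]
        by (simp only: atLeast0LessThan add_0)
      \<comment> \<open>The ratio 1/p is at most 1/2, so the geometric series contributes the factor
        2.\<close>
      also have "\<dots> \<le> (\<Sum>k<n. ln (real p) / real p ^ 2 * (1 / 2) ^ k)"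
      proof (intro sum_mono)
        fix k
        have "1 / real p ^ k \<le> (1 / 2) ^ k"
          using p by (auto simp: power_one_over divide_simps power_mono)
        then have "ln (real p) / real p ^ 2 * (1 / real p ^ k) \<le> ln (real p) / real p ^ 2 * (1 / 2) ^ k"
          using p by (intro mult_left_mono) auto
        then show "ln (real p) / real p ^ (k + 2) \<le> ln (real p) / real p ^ 2 * (1 / 2) ^ k"
          by (simp add: power_add mult_ac power2_eq_square)
      qed
      also have "\<dots> = ln (real p) / real p ^ 2 * (\<Sum>k<n. (1 / 2) ^ k)" by (simp add: sum_distrib_left)
      also have "\<dots> \<le> ln (real p) / real p ^ 2 * 2"
        using p by (intro mult_left_mono) (auto simp: sum_gp_strict)
      finally show "(\<Sum>k = 2..n. ln (real p) / real p ^ k) \<le> 2 * ln (real p) / real p ^ 2"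
        by (simp add: mult.commute)
    qed
    also have "\<dots> \<le> (\<Sum>p\<in>{2..n}. 2 * ln (real p) / real p ^ 2)"
      by (intro sum_mono2) auto
    finally show ?thesis .
  qed
  then show ?thesis using bd by (meson order_trans)
qed

text \<open>Both bounds compare ln(n!) with Legendre's formula. From below, n div d is at most n/d,
  and the proper prime powers cost a constant. From above, n div p is at least n/p - 1; here the
  prime powers are dropped, and the correction is the sum of ln p, which the primorial bound keeps
  below n ln 4.\<close>

theorem mertens_first:
  "\<exists>C. \<forall>n\<ge>1. \<bar>(\<Sum>p | prime p \<and> p \<le> n. ln (real p) / real p) - ln (real n)\<bar> \<le> C"
proof -
  obtain C where C: "\<And>n. (\<Sum>d | d \<in> {1..n} \<and> \<not> prime d. mangoldt d / real d) \<le> C"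
    using sum_mangoldt_nonprime_bounded by auto
  have "\<bar>(\<Sum>p | prime p \<and> p \<le> n. ln (real p) / real p) - ln (real n)\<bar> \<le> max (1 + C) (ln 4)" if n: "n \<ge> 1" for n :: nat
  proof -
    let ?A = "\<Sum>p | prime p \<and> p \<le> n. ln (real p) / real p"
    have split: "{1..n} = {p. prime p \<and> p \<le> n} \<union> {d. d \<in> {1..n} \<and> \<not> prime d}"
      using prime_ge_1_nat by auto
    have primes: "(\<Sum>p | prime p \<and> p \<le> n. mangoldt p * g p) = (\<Sum>p | prime p \<and> p \<le> n. ln (real p) * g p)" for g :: "nat \<Rightarrow> real"
      by (intro sum.cong) auto
    have "real n * ln (real n) - real n \<le> (\<Sum>d = 1..n. mangoldt d * real (n div d))"
      using ln_fact_ge[of n] ln_fact_mangoldt[of n] by simp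
    also have "\<dots> \<le> (\<Sum>d = 1..n. mangoldt d * (real n / real d))"
      by (intro sum_mono mult_left_mono mangoldt_nonneg of_nat_div_le_of_nat)
    also have "\<dots> = real n * (\<Sum>d = 1..n. mangoldt d / real d)"
      by (simp add: sum_distrib_left mult_ac)
    also have "(\<Sum>d = 1..n. mangoldt d / real d) = ?A + (\<Sum>d | d \<in> {1..n} \<and> \<not> prime d. mangoldt d / real d)"
      using primes[of "\<lambda>p. 1 / real p"] by (subst split, subst sum.union_disjoint) auto
    also have "real n * \<dots> \<le> real n * (?A + C)"
      by (intro mult_left_mono add_mono C) auto
    finally have "real n * (ln (real n) - 1) \<le> real n * (?A + C)" by (simp add: algebra_simps)
    then have lower: "ln (real n) - 1 \<le> ?A + C" using n by simp
    have "real n * ?A - (\<Sum>p | prime p \<and> p \<le> n. ln (real p))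
        = (\<Sum>p | prime p \<and> p \<le> n. ln (real p) * (real n / real p - 1))"
      by (simp add: sum_distrib_left sum_subtractf[symmetric] algebra_simps)
    also have "\<dots> = (\<Sum>p | prime p \<and> p \<le> n. mangoldt p * (real n / real p - 1))"
      by (rule primes[symmetric])
    also have "\<dots> \<le> (\<Sum>p | prime p \<and> p \<le> n. mangoldt p * real (n div p))"
    proof (intro sum_mono mult_left_mono mangoldt_nonneg)
      show "real n / real p - 1 \<le> real (n div p)" for p
        using floor_correct[of "real n / real p"] unfolding floor_divide_of_nat_eq by simp
    qed
    also have "\<dots> \<le> (\<Sum>d = 1..n. mangoldt d * real (n div d))"
      using prime_ge_1_nat by (intro sum_mono2) (auto simp: mangoldt_nonneg)
    also have "\<dots> \<le> real n * ln (real n)"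
      using ln_fact_le[of n] ln_fact_mangoldt[of n] by simp
    finally have "real n * ?A \<le> real n * (ln (real n) + ln 4)"
      using sum_ln_primes_le[of n] by (simp add: algebra_simps)
    then have "?A \<le> ln (real n) + ln 4" using n by simp
    with lower show ?thesis by linarith
  qed
  then show ?thesis by blast
qed

subsection \<open>Antiderivatives and bounded integrals\<close>

text \<open>The locally finite exceptional set admits the corners at the partition points.
  Continuity together with differentiability off that set is what the fundamental theorem of
  calculus asks for, and it survives sums and products. No derivative is demanded at the boundary
  point 2.\<close>

definition antideriv :: "(real \<Rightarrow> real) \<Rightarrow> (real \<Rightarrow> real) \<Rightarrow> bool" where
  "antideriv F f \<longleftrightarrow> continuous_on {2..} F \<and>
     (\<exists>S. (\<forall>X. finite (S \<inter> {2..X})) \<and> (\<forall>x>2. x \<notin> S \<longrightarrow> (F has_real_derivative f x) (at x)))"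

lemma antiderivI:
  assumes "continuous_on {2..} F" "\<And>x. x > 2 \<Longrightarrow> (F has_real_derivative f x) (at x)"
  shows "antideriv F f"
  unfolding antideriv_def using assms by (intro conjI exI[of _ "{}"]) auto

lemma antideriv_smooth:
  assumes "\<And>x. x \<ge> 2 \<Longrightarrow> (F has_real_derivative f x) (at x)"
  shows "antideriv F f"
  using assms by (intro antiderivI) (auto intro!: continuous_at_imp_continuous_on dest: DERIV_isCont)

lemma antideriv_add:
  assumes "antideriv F f" "antideriv G g"
  shows "antideriv (\<lambda>x. F x + G x) (\<lambda>x. f x + g x)"
proof -
  obtain S T where S: "\<forall>X. finite (S \<inter> {2..X})" "\<forall>x>2. x \<notin> S \<longrightarrow> (F has_real_derivative f x) (at x)"
    and T: "\<forall>X. finite (T \<inter> {2..X})" "\<forall>x>2. x \<notin> T \<longrightarrow> (G has_real_derivative g x) (at x)"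
    using assms unfolding antideriv_def by blast
  show ?thesis unfolding antideriv_def
    using S T assms by (intro conjI exI[of _ "S \<union> T"])
      (auto intro!: continuous_intros derivative_eq_intros simp: Int_Un_distrib2 antideriv_def)
qed

lemma antideriv_mult:
  assumes "antideriv F f" "antideriv G g"
  shows "antideriv (\<lambda>x. F x * G x) (\<lambda>x. f x * G x + F x * g x)"
proof -
  obtain S T where S: "\<forall>X. finite (S \<inter> {2..X})" "\<forall>x>2. x \<notin> S \<longrightarrow> (F has_real_derivative f x) (at x)"
    and T: "\<forall>X. finite (T \<inter> {2..X})" "\<forall>x>2. x \<notin> T \<longrightarrow> (G has_real_derivative g x) (at x)"
    using assms unfolding antideriv_def by blast
  show ?thesis unfolding antideriv_def
    using S T assms by (intro conjI exI[of _ "S \<union> T"])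
      (auto intro!: continuous_intros derivative_eq_intros simp: Int_Un_distrib2 antideriv_def)
qed

lemma antideriv_has_integral:
  assumes "antideriv F f" "2 \<le> a" "a \<le> b"
  shows "(f has_integral F b - F a) {a..b}"
proof -
  obtain S where S: "\<forall>X. finite (S \<inter> {2..X})" "\<forall>x>2. x \<notin> S \<longrightarrow> (F has_real_derivative f x) (at x)"
    using assms unfolding antideriv_def by blast
  show ?thesis
  proof (rule fundamental_theorem_of_calculus_interior_strong)
    show "finite (S \<inter> {2..b})" using S by auto
    show "continuous_on {a..b} F"
      using assms by (auto simp: antideriv_def intro: continuous_on_subset)
    show "(F has_vector_derivative f x) (at x)" if "x \<in> {a<..<b} - S \<inter> {2..b}" for x
      using that S assms by (auto simp: has_real_derivative_iff_has_vector_derivative[symmetric])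
  qed (use assms in auto)
qed

lemma antideriv_increment_bound:
  assumes F: "antideriv F f" and K: "antideriv K k"
    and ab: "2 \<le> a" "a \<le> b" and le: "\<And>x. a \<le> x \<Longrightarrow> \<bar>f x\<bar> \<le> C * k x"
  shows "\<bar>F b - F a\<bar> \<le> C * (K b - K a)"
proof -
  have "(f has_integral F b - F a) {a..b}" "((\<lambda>x. C * k x) has_integral C * (K b - K a)) {a..b}"
    using assms by (auto intro!: antideriv_has_integral has_integral_mult_right)
  moreover from this have "norm (integral {a..b} f) \<le> integral {a..b} (\<lambda>x. C * k x)"
    using le by (intro integral_norm_bound_integral) auto
  ultimately show ?thesis by (auto simp: has_integral_iff)
qed

text \<open>The derivatives compare only from some point \<open>a\<close> on. The constants
  \<open>F a\<close> and \<open>K a\<close> collected up to there are absorbed because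
  \<open>K\<close> tends to infinity and hence eventually exceeds 1.\<close>

lemma antideriv_bigo:
  assumes F: "antideriv F f" and K: "antideriv K k" and fk: "f \<in> O(k)"
    and pos: "eventually (\<lambda>x. 0 \<le> k x) at_top" and lim: "filterlim K at_top at_top"
  shows "F \<in> O(K)"
proof -
  obtain C where C: "C > 0" "eventually (\<lambda>x. norm (f x) \<le> C * norm (k x)) at_top"
    using fk by (elim landau_o.bigE)
  have "eventually (\<lambda>x. \<bar>f x\<bar> \<le> C * k x) at_top"
    using C(2) pos by eventually_elim auto
  then obtain x0 where x0: "\<And>x. x \<ge> x0 \<Longrightarrow> \<bar>f x\<bar> \<le> C * k x"
    by (auto simp: eventually_at_top_linorder)
  define a where "a = max x0 2"
  have inc: "\<bar>F x - F a\<bar> \<le> C * (K x - K a)" if "x \<ge> a" for x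
    using that x0 by (intro antideriv_increment_bound[OF F K]) (auto simp: a_def)
  define D where "D = \<bar>F a\<bar> + C * \<bar>K a\<bar>"
  have D: "D \<ge> 0" using C by (simp add: D_def)
  show ?thesis
  proof (rule landau_o.bigI[of "D + C"])
    show "eventually (\<lambda>x. norm (F x) \<le> (D + C) * norm (K x)) at_top"
      using eventually_ge_at_top[of a] filterlim_at_top_dense[THEN iffD1, OF lim, rule_format, of 1]
    proof eventually_elim
      case (elim x)
      have "- (C * K a) \<le> C * \<bar>K a\<bar>" using C by (metis abs_ge_minus_self mult_left_mono mult_minus_right less_imp_le)
      then have "\<bar>F x\<bar> \<le> D * 1 + C * K x"
        using inc[OF elim(1)] unfolding D_def by (simp add: algebra_simps)
      also have "\<dots> \<le> D * K x + C * K x" using D elim by (intro add_right_mono mult_left_mono) auto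
      finally show ?case using elim by (simp add: algebra_simps)
    qed
  qed (use C D in auto)
qed

lemma bigo_eventually_eq:
  "f \<in> O[F](g) \<Longrightarrow> eventually (\<lambda>x. f x = f' x) F \<Longrightarrow> f' \<in> O[F](g)"
  by (simp add: landau_o.big.in_cong)

text \<open>Dividing by ln(X / 2) turns a bounded integral of f into an error O(1 / ln X), so modulo
  functions of this kind the first claim becomes an identity between integrands.\<close>

definition bounded_integral :: "(real \<Rightarrow> real) \<Rightarrow> bool" where
  "bounded_integral f \<longleftrightarrow> (\<forall>X. f integrable_on {2..X}) \<and> (\<lambda>X. integral {2..X} f) \<in> O(\<lambda>_. 1)"

lemma bounded_integralI:
  assumes "\<And>X. X \<ge> 2 \<Longrightarrow> (f has_integral J X) {2..X}" "J \<in> O(\<lambda>_. 1)"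
  shows "bounded_integral f"
  unfolding bounded_integral_def
proof (intro conjI allI)
  show "f integrable_on {2..X}" for X
    using assms(1)[of X] by (cases "X \<ge> 2") (auto simp: has_integral_integrable)
  have "eventually (\<lambda>X. J X = integral {2..X} f) at_top"
    using eventually_ge_at_top[of 2] by eventually_elim (use assms(1) integral_unique in metis)
  then show "(\<lambda>X. integral {2..X} f) \<in> O(\<lambda>_. 1)"
    by (rule bigo_eventually_eq[OF assms(2)])
qed

lemma bounded_integral_cong:
  assumes "bounded_integral f" "\<And>x. x \<ge> 2 \<Longrightarrow> f x = g x"
  shows "bounded_integral g"
proof -
  have "integral {2..X} f = integral {2..X} g" "f integrable_on {2..X} \<longleftrightarrow> g integrable_on {2..X}" for X
    using assms(2) by (auto intro!: integral_cong integrable_cong)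
  then show ?thesis using assms(1) unfolding bounded_integral_def by simp
qed

lemma bounded_integral_add:
  assumes "bounded_integral f" "bounded_integral g"
  shows "bounded_integral (\<lambda>x. f x + g x)"
proof (rule bounded_integralI)
  show "((\<lambda>x. f x + g x) has_integral (integral {2..X} f + integral {2..X} g)) {2..X}" for X
    using assms by (intro has_integral_add) (auto simp: bounded_integral_def)
  show "(\<lambda>X. integral {2..X} f + integral {2..X} g) \<in> O(\<lambda>_. 1)"
    using assms by (intro sum_in_bigo) (auto simp: bounded_integral_def)
qed

lemma bounded_integral_cmult:
  assumes "bounded_integral f"
  shows "bounded_integral (\<lambda>x. c * f x)"
proof (rule bounded_integralI)
  show "((\<lambda>x. c * f x) has_integral (c * integral {2..X} f)) {2..X}" for X
    using assms by (intro has_integral_mult_right) (auto simp: bounded_integral_def)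
  show "(\<lambda>X. c * integral {2..X} f) \<in> O(\<lambda>_. 1)"
    using assms by (cases "c = 0") (auto simp: bounded_integral_def)
qed

lemma bounded_integral_diff:
  assumes "bounded_integral f" "bounded_integral g"
  shows "bounded_integral (\<lambda>x. f x - g x)"
  using bounded_integral_add[OF assms(1) bounded_integral_cmult[OF assms(2), of "-1"]] by simp

lemma bounded_integral_antideriv:
  assumes "antideriv F f" "F \<in> O(\<lambda>_. 1)"
  shows "bounded_integral f"
proof (rule bounded_integralI)
  show "(f has_integral F X - F 2) {2..X}" if "X \<ge> 2" for X
    using that assms by (intro antideriv_has_integral) auto
  show "(\<lambda>X. F X - F 2) \<in> O(\<lambda>_. 1)" using assms by (intro sum_in_bigo) auto
qed

lemma antideriv_neg_inverse_ln: "antideriv (\<lambda>x. - 1 / ln x) (\<lambda>x. 1 / (x * ln x ^ 2))"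
  by (rule antideriv_smooth) (auto intro!: derivative_eq_intros simp: power2_eq_square field_simps)

lemma antideriv_ln_ln: "antideriv (\<lambda>x. ln (ln x)) (\<lambda>x. 1 / (x * ln x))"
  by (rule antideriv_smooth) (auto intro!: derivative_eq_intros simp: field_simps)

text \<open>The comparison function has the bounded antiderivative -1 / ln x. It is the yardstick
  for every absolutely convergent error below.\<close>

lemma bounded_integral_bigo:
  assumes int: "\<And>X. f integrable_on {2..X}" and bo: "f \<in> O(\<lambda>x. 1 / (x * ln x ^ 2))"
  shows "bounded_integral f"
proof -
  obtain C where C: "C > 0" "eventually (\<lambda>x. norm (f x) \<le> C * norm (1 / (x * ln x ^ 2))) at_top"
    using bo by (elim landau_o.bigE)
  have "eventually (\<lambda>x. \<bar>f x\<bar> \<le> C * (1 / (x * ln x ^ 2))) at_top"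
    using C(2) eventually_ge_at_top[of 2] by eventually_elim auto
  then obtain x0 where x0: "\<And>x. x \<ge> x0 \<Longrightarrow> \<bar>f x\<bar> \<le> C * (1 / (x * ln x ^ 2))"
    by (auto simp: eventually_at_top_linorder)
  define a where "a = max x0 2"
  have "\<bar>integral {2..X} f\<bar> \<le> \<bar>integral {2..a} f\<bar> + C / ln 2" if X: "X \<ge> a" for X
  proof -
    have k: "((\<lambda>x. C * (1 / (x * ln x ^ 2))) has_integral C * (- 1 / ln X - (- 1 / ln a))) {a..X}"
      using X by (intro has_integral_mult_right antideriv_has_integral antideriv_neg_inverse_ln) (auto simp: a_def)
    have fi: "f integrable_on {a..X}"
      using int[of X] by (rule integrable_on_subinterval) (auto simp: a_def)
    have "norm (integral {a..X} f) \<le> integral {a..X} (\<lambda>x. C * (1 / (x * ln x ^ 2)))"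
      using x0 fi k by (intro integral_norm_bound_integral) (auto simp: a_def has_integral_integrable)
    also have "\<dots> = C / ln a - C / ln X" using k by (simp add: has_integral_iff algebra_simps)
    also have "\<dots> \<le> C / ln a" using X C by (simp add: a_def)
    also have "\<dots> \<le> C / ln 2" using C by (intro divide_left_mono) (auto simp: a_def)
    finally have "\<bar>integral {a..X} f\<bar> \<le> C / ln 2" by simp
    moreover have "integral {2..X} f = integral {2..a} f + integral {a..X} f"
      using X int by (intro Henstock_Kurzweil_Integration.integral_combine[symmetric]) (auto simp: a_def)
    ultimately show ?thesis by linarith
  qed
  then have "eventually (\<lambda>X. norm (integral {2..X} f) \<le> (\<bar>integral {2..a} f\<bar> + C / ln 2) * norm (1 :: real)) at_top"
    unfolding eventually_at_top_linorder by auto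
  then have "(\<lambda>X. integral {2..X} f) \<in> O(\<lambda>_. 1)" by (rule bigoI)
  then show ?thesis unfolding bounded_integral_def using int by blast
qed

section \<open>Partial summation over primes and Mertens' second theorem\<close>

definition prime_sum :: "(nat \<Rightarrow> real) \<Rightarrow> real \<Rightarrow> real" where
  "prime_sum a x = (\<Sum>p | prime p \<and> real p \<le> x. a p)"

lemma finite_primes_le: "finite {p :: nat. prime p \<and> real p \<le> x}"
proof (rule finite_subset)
  show "{p :: nat. prime p \<and> real p \<le> x} \<subseteq> {..nat \<lfloor>x\<rfloor>}" by (auto simp: le_nat_floor)
qed simp

lemma prime_pi_prime_sum: "prime_pi x = prime_sum (\<lambda>_. 1) x"
  by (simp add: prime_pi_def prime_sum_def)

text \<open>Exchange of sum and integral: a prime p up to X contributes \<open>a p\<close> times the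
  integral of f over [p, X], which is F X - F p.\<close>

lemma abel_summation:
  assumes "antideriv F f" and X: "X \<ge> 2"
  shows "((\<lambda>x. prime_sum a x * f x) has_integral
           (prime_sum a X * F X - prime_sum (\<lambda>p. a p * F (real p)) X)) {2..X}"
proof -
  let ?P = "{p :: nat. prime p \<and> real p \<le> X}"
  have "((\<lambda>x. \<Sum>p\<in>?P. a p * (if x \<in> {real p..X} then f x else 0)) has_integral
          (\<Sum>p\<in>?P. a p * (F X - F (real p)))) {2..X}"
  proof (intro has_integral_sum has_integral_mult_right finite_primes_le)
    fix p assume p: "p \<in> ?P"
    then have "real p \<ge> 2" using prime_ge_2_nat by auto
    then show "((\<lambda>x. if x \<in> {real p..X} then f x else 0) has_integral (F X - F (real p))) {2..X}"
      using p assms by (subst has_integral_restrict) (auto intro: antideriv_has_integral)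
  qed
  also have "?this \<longleftrightarrow> ((\<lambda>x. prime_sum a x * f x) has_integral
          (\<Sum>p\<in>?P. a p * (F X - F (real p)))) {2..X}"
  proof (intro has_integral_cong)
    fix x assume x: "x \<in> {2..X}"
    have "(\<Sum>p\<in>?P. a p * (if x \<in> {real p..X} then f x else 0)) = (\<Sum>p | prime p \<and> real p \<le> x. a p * f x)"
      using x finite_primes_le by (intro sum.mono_neutral_cong_right) auto
    then show "(\<Sum>p\<in>?P. a p * (if x \<in> {real p..X} then f x else 0)) = prime_sum a x * f x"
      by (simp add: prime_sum_def sum_distrib_right)
  qed
  also have "(\<Sum>p\<in>?P. a p * (F X - F (real p))) = prime_sum a X * F X - prime_sum (\<lambda>p. a p * F (real p)) X"
    by (simp add: prime_sum_def right_diff_distrib sum_subtractf sum_distrib_right)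
  finally show ?thesis .
qed

lemma mertens_first_real:
  "\<exists>C. \<forall>x\<ge>2. \<bar>prime_sum (\<lambda>p. ln (real p) / real p) x - ln x\<bar> \<le> C"
proof -
  obtain C where C: "\<And>n. n \<ge> 1 \<Longrightarrow> \<bar>(\<Sum>p | prime p \<and> p \<le> n. ln (real p) / real p) - ln (real n)\<bar> \<le> C"
    using mertens_first by blast
  have "\<bar>prime_sum (\<lambda>p. ln (real p) / real p) x - ln x\<bar> \<le> C + ln 2" if x: "x \<ge> 2" for x
  proof -
    define n where "n = nat \<lfloor>x\<rfloor>"
    have n: "n \<ge> 2" "real n \<le> x" "x < real n + 1"
      using x by (auto simp: n_def le_nat_floor)
    have "{p :: nat. prime p \<and> real p \<le> x} = {p. prime p \<and> p \<le> n}"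
      using n by auto
    then have eq: "prime_sum (\<lambda>p. ln (real p) / real p) x = (\<Sum>p | prime p \<and> p \<le> n. ln (real p) / real p)"
      by (simp add: prime_sum_def)
    \<comment> \<open>With n the floor of x one has x < n + 1, which is at most 2n; this is where
      the extra ln 2 comes from.\<close>
    have "ln x \<le> ln (2 * real n)" using n by (subst ln_le_cancel_iff) auto
    also have "\<dots> = ln 2 + ln (real n)" using n by (simp add: ln_mult)
    finally have "ln x \<le> ln 2 + ln (real n)" .
    moreover have "ln (real n) \<le> ln x" using n by simp
    moreover have "\<bar>(\<Sum>p | prime p \<and> p \<le> n. ln (real p) / real p) - ln (real n)\<bar> \<le> C"
      using C[of n] n(1) by linarith
    ultimately show ?thesis unfolding eq by linarith
  qed
  then show ?thesis by blast
qed

text \<open>Write 1/p as (ln p / p) * (1 / ln p) and sum by parts with the antiderivative -1 / ln x.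
  By the first theorem the partial sums are ln x + O(1): the main part integrates to ln ln X and the
  error is O(1 / (x (ln x)^2)).\<close>

theorem mertens_second:
  "(\<lambda>x. prime_sum (\<lambda>p. 1 / real p) x - ln (ln x)) \<in> O(\<lambda>_. 1)"
proof -
  let ?A = "prime_sum (\<lambda>p. ln (real p) / real p)"
  obtain C where C: "\<And>x. x \<ge> 2 \<Longrightarrow> \<bar>?A x - ln x\<bar> \<le> C"
    using mertens_first_real by blast
  have i1: "((\<lambda>x. ?A x * (1 / (x * ln x ^ 2))) has_integral
      (?A X * (- 1 / ln X) - prime_sum (\<lambda>p. ln (real p) / real p * (- 1 / ln (real p))) X)) {2..X}" if "X \<ge> 2" for X
    using that by (intro abel_summation antideriv_neg_inverse_ln)
  have sum_eq: "prime_sum (\<lambda>p. ln (real p) / real p * (- 1 / ln (real p))) X = - prime_sum (\<lambda>p. 1 / real p) X" for X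
    unfolding prime_sum_def sum_negf[symmetric]
  proof (intro sum.cong refl)
    fix p :: nat assume "p \<in> {p. prime p \<and> real p \<le> X}"
    then have "ln (real p) \<noteq> 0" using prime_gt_1_nat[of p] by auto
    then show "ln (real p) / real p * (- 1 / ln (real p)) = - (1 / real p)" by simp
  qed
  have i2: "((\<lambda>x. 1 / (x * ln x)) has_integral (ln (ln X) - ln (ln 2))) {2..X}" if "X \<ge> 2" for X :: real
    using that by (intro antideriv_has_integral antideriv_ln_ln) auto
  let ?f = "\<lambda>x. ?A x * (1 / (x * ln x ^ 2)) - 1 / (x * ln x)"
  have i3: "(?f has_integral (prime_sum (\<lambda>p. 1 / real p) X - ?A X / ln X - (ln (ln X) - ln (ln 2)))) {2..X}" if "X \<ge> 2" for X
    using has_integral_diff[OF i1[OF that] i2[OF that]] unfolding sum_eq by simp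
  have "bounded_integral ?f"
  proof (rule bounded_integral_bigo)
    show "?f integrable_on {2..X}" for X
      using i3[of X] by (cases "X \<ge> 2") (auto simp: has_integral_integrable)
    show "?f \<in> O(\<lambda>x. 1 / (x * ln x ^ 2))"
    proof (rule landau_o.bigI[of "max 1 C"])
      show "eventually (\<lambda>x. norm (?f x) \<le> max 1 C * norm (1 / (x * ln x ^ 2))) at_top"
        using eventually_ge_at_top[of 2]
      proof eventually_elim
        case (elim x)
        have "?f x = (?A x - ln x) * (1 / (x * ln x ^ 2))"
          using elim by (simp add: field_simps power2_eq_square)
        then show ?case using C[OF elim] by (simp add: abs_mult divide_right_mono)
      qed
    qed auto
  qed
  then have "(\<lambda>X. integral {2..X} ?f) \<in> O(\<lambda>_. 1)"
    unfolding bounded_integral_def by blast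
  moreover have "(\<lambda>X. (?A X - ln X) / ln X) \<in> O(\<lambda>_. 1)"
  proof (rule landau_o.bigI[of "max 1 (C / ln 2)"])
    show "eventually (\<lambda>X. norm ((?A X - ln X) / ln X) \<le> max 1 (C / ln 2) * norm (1 :: real)) at_top"
      using eventually_ge_at_top[of 2]
    proof eventually_elim
      case (elim X)
      have "\<bar>?A X - ln X\<bar> / ln X \<le> C / ln 2" using C[OF elim] elim by (intro frac_le) auto
      then show ?case using elim by (simp add: abs_divide)
    qed
  qed auto
  moreover have "(\<lambda>X. 1 - ln (ln 2)) \<in> O(\<lambda>_. 1 :: real)" by simp
  ultimately have "(\<lambda>X. integral {2..X} ?f + (?A X - ln X) / ln X + (1 - ln (ln 2))) \<in> O(\<lambda>_. 1)"
    by (rule sum_in_bigo(1)[OF sum_in_bigo(1)])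
  moreover have "eventually (\<lambda>X. integral {2..X} ?f + (?A X - ln X) / ln X + (1 - ln (ln 2)) =
      prime_sum (\<lambda>p. 1 / real p) X - ln (ln X)) at_top"
    using eventually_ge_at_top[of 2]
  proof eventually_elim
    case (elim X)
    have "(?A X - ln X) / ln X = ?A X / ln X - 1" using elim by (simp add: diff_divide_distrib)
    then show ?case using integral_unique[OF i3[OF elim]] by simp
  qed
  ultimately show ?thesis by (rule bigo_eventually_eq)
qed

subsection \<open>The logarithmic integral\<close>

text \<open>Subtracting the simple pole at 1 leaves a bounded function, whence the principal value exists.
  The bounds also hold at the junk values \<open>t = 0\<close> and \<open>t = 1\<close>.\<close>

lemma inverse_ln_pole_bounds:
  assumes "(t :: real) \<ge> 0"
  shows "0 \<le> 1 / ln t - 1 / (t - 1)" "1 / ln t - 1 / (t - 1) \<le> 1"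
proof -
  have *: "0 \<le> 1 / ln t - 1 / (t - 1) \<and> 1 / ln t - 1 / (t - 1) \<le> 1"
  proof (cases "t = 0 \<or> t = 1")
    case False
    then have t: "t > 0" "t \<noteq> 1" using assms by auto
    \<comment> \<open>The inequality ln y <= y - 1, used at t and at 1/t, encloses ln t between (t -
      1)/t and t - 1; taking reciprocals gives both bounds on either side of 1.\<close>
    have up: "ln t \<le> t - 1" using t by (intro ln_le_minus_one)
    have "ln (1 / t) \<le> 1 / t - 1" using t by (intro ln_le_minus_one) auto
    then have "t * (1 - 1 / t) \<le> t * ln t" using t by (intro mult_left_mono) (auto simp: ln_div)
    then have lo: "t - 1 \<le> t * ln t" using t by (simp add: right_diff_distrib)
    have eq: "1 + 1 / (t - 1) = t / (t - 1)" using t by (simp add: field_simps)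
    consider "t > 1" | "t < 1" using t by linarith
    then have "1 / (t - 1) \<le> 1 / ln t \<and> 1 / ln t \<le> t / (t - 1)"
    proof cases
      case 1
      then have "ln t > 0" by simp
      then show ?thesis using 1 up lo by (auto intro!: divide_left_mono simp: divide_le_eq le_divide_eq)
    next
      case 2
      then have "ln t < 0" using t by simp
      then show ?thesis using 2 up lo by (auto simp: divide_le_eq le_divide_eq mult.commute)
    qed
    then show ?thesis unfolding eq[symmetric] by simp
  qed auto
  then show "0 \<le> 1 / ln t - 1 / (t - 1)" "1 / ln t - 1 / (t - 1) \<le> 1" by auto
qed

text \<open>The pole 1 / (t - 1) contributes ln e over [0, 1 - e] and - ln e over [1 + e, 2]; the
  symmetric excision cancels them. What remains is continuous in e, so the limit exists and c is the
  integral over [0, 2] of 1 / ln t with its pole removed. Splitting at 2 makes the logarithm at the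
  far end vanish.\<close>

lemma li_eq_integral: "\<exists>c. \<forall>x\<ge>2. li x = c + integral {2..x} (\<lambda>t. 1 / ln t)"
proof -
  define K :: "real \<Rightarrow> real" where "K = (\<lambda>t. 1 / ln t - 1 / (t - 1))"
  have Kint: "K integrable_on {0..2}"
  proof (rule measurable_bounded_by_integrable_imp_integrable_real[where g = "\<lambda>_. 1"])
    have "K \<in> borel_measurable borel" unfolding K_def by measurable
    then show "K \<in> borel_measurable (lebesgue_on {0..2})"
      by (intro measurable_restrict_space1 measurable_completion) simp
    show "\<bar>K x\<bar> \<le> 1" if "x \<in> {0..2}" for x
      using inverse_ln_pole_bounds[of x] that by (auto simp: K_def)
  qed auto
  then have Ksub: "K integrable_on {a..b}" if "0 \<le> a" "b \<le> 2" for a b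
    using that by (auto intro: integrable_on_subinterval)
  define I where "I = (\<lambda>y. integral {0..y} K)"
  have "isCont I 1"
  proof -
    have "continuous_on {0..2} I" unfolding I_def using Kint by (rule indefinite_integral_continuous_1)
    then have "continuous_on {0<..<2} I" by (rule continuous_on_subset) auto
    then show ?thesis by (auto simp: continuous_on_eq_continuous_at)
  qed
  have I1: "((\<lambda>e. I (1 - e)) \<longlongrightarrow> I 1) (at_right 0)" "((\<lambda>e. I (1 + e)) \<longlongrightarrow> I 1) (at_right 0)"
    by (rule isCont_tendsto_compose[OF \<open>isCont I 1\<close>]; real_asymp)+
  have "li x = I 2 + integral {2..x} (\<lambda>t. 1 / ln t)" if x: "x \<ge> 2" for x
  proof -
    have lnint: "(\<lambda>t. 1 / ln t) integrable_on {a..x}" if "a > 1" for a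
      using that by (intro integrable_continuous_real continuous_intros) auto
    let ?g = "\<lambda>e. integral {0..1 - e} (\<lambda>t. 1 / ln t) + integral {1 + e..x} (\<lambda>t. 1 / ln t)"
    have eq: "?g e = I (1 - e) + (I 2 - I (1 + e)) + integral {2..x} (\<lambda>t. 1 / ln t)" if e: "0 < e" "e < 1" for e
    proof -
      have "((\<lambda>t. 1 / (t - 1)) has_integral (ln (1 - (1 - e)) - ln (1 - 0))) {0..1 - e}"
        using e by (intro fundamental_theorem_of_calculus)
          (auto intro!: derivative_eq_intros simp: has_real_derivative_iff_has_vector_derivative[symmetric] divide_simps)
      from has_integral_add[OF integrable_integral[OF Ksub[of 0 "1 - e"]] this] e
      have 1: "integral {0..1 - e} (\<lambda>t. 1 / ln t) = I (1 - e) + ln e"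
        by (auto simp: K_def I_def has_integral_iff)
      have "((\<lambda>t. 1 / (t - 1)) has_integral (ln (2 - 1) - ln (1 + e - 1))) {1 + e..2}"
        using e by (intro fundamental_theorem_of_calculus)
          (auto intro!: derivative_eq_intros simp: has_real_derivative_iff_has_vector_derivative[symmetric] divide_simps)
      from has_integral_add[OF integrable_integral[OF Ksub[of "1 + e" 2]] this] e
      have 2: "integral {1 + e..2} (\<lambda>t. 1 / ln t) = integral {1 + e..2} K - ln e"
        by (auto simp: K_def has_integral_iff)
      have 3: "I 2 = I (1 + e) + integral {1 + e..2} K"
        unfolding I_def using e Kint
        by (intro Henstock_Kurzweil_Integration.integral_combine[symmetric]) auto
      have 4: "integral {1 + e..x} (\<lambda>t. 1 / ln t) = integral {1 + e..2} (\<lambda>t. 1 / ln t) + integral {2..x} (\<lambda>t. 1 / ln t)"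
        using e x lnint[of "1 + e"]
        by (intro Henstock_Kurzweil_Integration.integral_combine[symmetric]) auto
      show ?thesis using 1 2 3 4 by simp
    qed
    have "((\<lambda>e. I (1 - e) + (I 2 - I (1 + e)) + integral {2..x} (\<lambda>t. 1 / ln t)) \<longlongrightarrow>
             I 1 + (I 2 - I 1) + integral {2..x} (\<lambda>t. 1 / ln t)) (at_right 0)"
      by (intro tendsto_intros I1)
    moreover have "eventually (\<lambda>e. I (1 - e) + (I 2 - I (1 + e)) + integral {2..x} (\<lambda>t. 1 / ln t) = ?g e) (at_right 0)"
      using eventually_at_right_less[of 0] eventually_at_right_real[of 0 1]
      by (auto elim!: eventually_mono simp: eq)
    ultimately have "(?g \<longlongrightarrow> I 1 + (I 2 - I 1) + integral {2..x} (\<lambda>t. 1 / ln t)) (at_right 0)"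
      by (rule Lim_transform_eventually)
    then show ?thesis unfolding li_def by (subst tendsto_Lim) auto
  qed
  then show ?thesis by blast
qed

lemma continuous_on_atLeastI:
  fixes f :: "real \<Rightarrow> real"
  assumes "\<And>X. continuous_on {a..X} f"
  shows "continuous_on {a..} f"
  unfolding continuous_on_eq_continuous_within
proof
  fix x assume x: "x \<in> {a..}"
  then have "continuous (at x within {a..x + 1}) f"
    using assms[of "x + 1"] by (auto simp: continuous_on_eq_continuous_within)
  moreover have "at x within {a..x + 1} = at x within {a..}"
    by (rule at_within_nhd[of x "{..<x + 1}"]) auto
  ultimately show "continuous (at x within {a..}) f" by (simp add: continuous_within)
qed

lemma antideriv_li: "antideriv li (\<lambda>x. 1 / ln x)"
proof -
  obtain c where c: "\<And>x. x \<ge> 2 \<Longrightarrow> li x = c + integral {2..x} (\<lambda>t. 1 / ln t)"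
    using li_eq_integral by blast
  have cont: "continuous_on {2..X} (\<lambda>t :: real. 1 / ln t)" for X
    by (intro continuous_intros) auto
  have contJ: "continuous_on {2..X} (\<lambda>x. integral {2..x} (\<lambda>t. 1 / ln t))" for X :: real
    using cont by (intro indefinite_integral_continuous_1 integrable_continuous_real)
  have "continuous_on {2..X} li" for X
    by (rule continuous_on_cong[THEN iffD2, OF refl c]) (auto intro!: continuous_intros contJ)
  moreover have "(li has_real_derivative 1 / ln x) (at x)" if x: "x > 2" for x
  proof -
    have "((\<lambda>x. integral {2..x} (\<lambda>t. 1 / ln t)) has_real_derivative 1 / ln x) (at x within {2..x + 1})"
      using x cont[of "x + 1"] by (intro integral_has_real_derivative) auto
    then have "((\<lambda>x. integral {2..x} (\<lambda>t. 1 / ln t)) has_real_derivative 1 / ln x) (at x within {2<..<x + 1})"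
      by (rule DERIV_subset) auto
    then have "((\<lambda>x. integral {2..x} (\<lambda>t. 1 / ln t)) has_real_derivative 1 / ln x) (at x)"
      using x at_within_open[of x "{2<..<x + 1}"] by simp
    then have "((\<lambda>x. c + integral {2..x} (\<lambda>t. 1 / ln t)) has_real_derivative 1 / ln x) (at x)"
      using DERIV_add[OF DERIV_const[of c]] by fastforce
    then show ?thesis
      by (rule has_field_derivative_transform_within_open[where S = "{2<..}"]) (use x c in auto)
  qed
  ultimately show ?thesis by (intro antiderivI continuous_on_atLeastI)
qed

lemma li_bigo: "li \<in> O(\<lambda>x. x)"
proof (rule antideriv_bigo[OF antideriv_li])
  show "antideriv (\<lambda>x. x) (\<lambda>_. 1)" by (rule antideriv_smooth) (auto intro!: derivative_eq_intros)
  show "(\<lambda>x :: real. 1 / ln x) \<in> O(\<lambda>_. 1)" by real_asymp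
qed (auto simp: filterlim_ident)

lemma prime_pi_le: "x \<ge> 0 \<Longrightarrow> prime_pi x \<le> x"
proof -
  assume x: "x \<ge> 0"
  have "card {p :: nat. prime p \<and> real p \<le> x} \<le> card {1..nat \<lfloor>x\<rfloor>}"
    using prime_ge_1_nat by (intro card_mono) (auto simp: le_nat_floor)
  then have "prime_pi x \<le> real (nat \<lfloor>x\<rfloor>)" by (simp add: prime_pi_def)
  also have "\<dots> \<le> x" using x by linarith
  finally show ?thesis .
qed

lemma prime_pi_nonneg: "prime_pi x \<ge> 0"
  by (simp add: prime_pi_def)

lemma prime_pi_bigo: "prime_pi \<in> O(\<lambda>x. x)"
proof (rule bigoI)
  show "eventually (\<lambda>x. norm (prime_pi x) \<le> 1 * norm x) at_top"
    using eventually_ge_at_top[of 0] by eventually_elim (simp add: prime_pi_le prime_pi_nonneg)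
qed

section \<open>Integrals against li - pi\<close>

text \<open>Integration by parts turns the integral of li(x) / x^2 into ln ln X - li(X) / X, and
  partial summation turns that of pi(x) / x^2 into the sum of 1/p minus pi(X) / X, both up to
  constants. The double logarithms cancel by Mertens' second theorem.\<close>

lemma bounded_integral_li_pi_square: "bounded_integral (\<lambda>x. (li x - prime_pi x) / x ^ 2)"
proof (rule bounded_integralI)
  have ai: "antideriv (\<lambda>x. - 1 / x) (\<lambda>x. 1 / x ^ 2)"
    by (rule antideriv_smooth) (auto intro!: derivative_eq_intros simp: power2_eq_square field_simps)
  let ?F = "\<lambda>x. li x * (- 1 / x) + ln (ln x)"
  let ?S = "prime_sum (\<lambda>p. 1 / real p)"
  let ?J = "\<lambda>X. (ln (ln X) - ?S X) + (prime_pi X - li X) / X - ?F 2"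
  have aF: "antideriv ?F (\<lambda>x. 1 / ln x * (- 1 / x) + li x * (1 / x ^ 2) + 1 / (x * ln x))"
    by (intro antideriv_add antideriv_mult antideriv_li ai antideriv_ln_ln)
  show "((\<lambda>x. (li x - prime_pi x) / x ^ 2) has_integral ?J X) {2..X}" if X: "X \<ge> 2" for X
  proof -
    have "((\<lambda>x. 1 / ln x * (- 1 / x) + li x * (1 / x ^ 2) + 1 / (x * ln x)) has_integral (?F X - ?F 2)) {2..X}"
      using X by (intro antideriv_has_integral aF) auto
    also have "?this \<longleftrightarrow> ((\<lambda>x. li x / x ^ 2) has_integral (?F X - ?F 2)) {2..X}"
      by (intro has_integral_cong) (auto simp: mult.commute)
    finally have 1: "((\<lambda>x. li x / x ^ 2) has_integral (?F X - ?F 2)) {2..X}" .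
    have "((\<lambda>x. prime_sum (\<lambda>_. 1) x * (1 / x ^ 2)) has_integral
        (prime_sum (\<lambda>_. 1) X * (- 1 / X) - prime_sum (\<lambda>p. 1 * (- 1 / real p)) X)) {2..X}"
      using X by (intro abel_summation ai)
    moreover have "prime_sum (\<lambda>p. 1 * (- 1 / real p)) X = - ?S X"
      by (simp add: prime_sum_def sum_negf)
    ultimately have "((\<lambda>x. prime_pi x / x ^ 2) has_integral (?S X - prime_pi X / X)) {2..X}"
      by (simp add: prime_pi_prime_sum)
    from has_integral_diff[OF 1 this] show ?thesis by (simp add: diff_divide_distrib algebra_simps)
  qed
  have "(\<lambda>X. ln (ln X) - ?S X) \<in> O(\<lambda>_. 1)"
    using mertens_second by (subst landau_o.big.uminus_in_iff[symmetric]) simp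
  moreover have "(\<lambda>X. (prime_pi X - li X) / X) \<in> O(\<lambda>X. X / X)"
    by (intro landau_o.big.divide_right sum_in_bigo li_bigo prime_pi_bigo) (auto simp: eventually_gt_at_top intro: eventually_mono[OF eventually_gt_at_top[of 0]])
  then have "(\<lambda>X. (prime_pi X - li X) / X) \<in> O(\<lambda>X. 1)"
    by (rule landau_o.big_trans) real_asymp
  moreover have "(\<lambda>X. ?F 2) \<in> O(\<lambda>X. 1 :: real)" by simp
  ultimately show "?J \<in> O(\<lambda>_. 1)" by (rule sum_in_bigo(2)[OF sum_in_bigo(1)])
qed

text \<open>The derivative is moved off K. For li this leaves the bounded boundary term li * K and
  the convergent integral of K / ln x; for pi it leaves pi * K and a sum of K over primes, dominated
  by the absolutely convergent sum over all integers. The exponent -5/4 is below -1 for convergence,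
  yet above -3/2 so as to absorb the logarithm in the K to which this is applied.\<close>

lemma bounded_integral_li_pi_deriv:
  assumes K: "antideriv K k" "K \<in> O(\<lambda>x. x powr (-5/4))"
  shows "bounded_integral (\<lambda>x. (li x - prime_pi x) * k x)"
proof -
  have K1: "(\<lambda>x. f x * K x) \<in> O(\<lambda>_. 1)" if "f \<in> O(\<lambda>x. x)" for f
    by (rule landau_o.big_trans[OF landau_o.big.mult[OF that K(2)]]) real_asymp
  have "bounded_integral (\<lambda>x. 1 / ln x * K x + li x * k x)"
    by (rule bounded_integral_antideriv[OF antideriv_mult[OF antideriv_li K(1)] K1[OF li_bigo]])
  moreover have "bounded_integral (\<lambda>x. 1 / ln x * K x)"
  proof (rule bounded_integral_bigo)
    have "continuous_on {2..X} K" for X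
      using K(1) by (auto simp: antideriv_def intro: continuous_on_subset)
    then show "(\<lambda>x. 1 / ln x * K x) integrable_on {2..X}" for X
      by (intro integrable_continuous_real continuous_intros) auto
    have "(\<lambda>x. 1 / ln x * K x) \<in> O(\<lambda>x. 1 / ln x * x powr (-5/4))"
      by (intro landau_o.big.mult K) auto
    also have "(\<lambda>x :: real. 1 / ln x * x powr (-5/4)) \<in> O(\<lambda>x. 1 / (x * ln x ^ 2))"
      by real_asymp
    finally show "(\<lambda>x. 1 / ln x * K x) \<in> O(\<lambda>x. 1 / (x * ln x ^ 2))" .
  qed
  ultimately have "bounded_integral (\<lambda>x. (1 / ln x * K x + li x * k x) - 1 / ln x * K x)"
    by (rule bounded_integral_diff)
  then have li: "bounded_integral (\<lambda>x. li x * k x)" by simp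
  have pi: "bounded_integral (\<lambda>x. prime_pi x * k x)"
  proof (rule bounded_integralI)
    show "((\<lambda>x. prime_pi x * k x) has_integral
        (prime_pi X * K X - prime_sum (\<lambda>p. 1 * K (real p)) X)) {2..X}" if "X \<ge> 2" for X
      unfolding prime_pi_prime_sum using that by (intro abel_summation K)
    have "summable (\<lambda>n. norm (K (real n)))"
    proof (rule summable_comparison_test_bigo)
      show "summable (\<lambda>n. norm (real n powr (-5/4)))" by (simp add: summable_real_powr_iff)
      have "(\<lambda>n. K (real n)) \<in> O(\<lambda>n. real n powr (-5/4))"
        by (rule landau_o.big.compose[OF K(2) filterlim_real_sequentially])
      then show "(\<lambda>n. norm (K (real n))) \<in> O(\<lambda>n. real n powr (-5/4))" by simp
    qed
    then have "norm (prime_sum (\<lambda>p. 1 * K (real p)) X) \<le> suminf (\<lambda>n. norm (K (real n)))" for X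
      unfolding prime_sum_def using finite_primes_le[of X]
      by (intro order_trans[OF norm_sum]) (auto intro: sum_le_suminf)
    then have "prime_sum (\<lambda>p. 1 * K (real p)) \<in> O(\<lambda>_. 1)"
      by (intro bigoI[of _ "suminf (\<lambda>n. norm (K (real n)))"]) auto
    then show "(\<lambda>X. prime_pi X * K X - prime_sum (\<lambda>p. 1 * K (real p)) X) \<in> O(\<lambda>_. 1)"
      by (intro sum_in_bigo K1 prime_pi_bigo)
  qed
  show ?thesis using bounded_integral_diff[OF li pi] by (simp add: left_diff_distrib)
qed

section \<open>Local boundedness and integrability\<close>

text \<open>Integrability alone is not closed under products. Measurability with boundedness on
  compact intervals is, and it implies integrability there.\<close>

definition locally_bounded :: "(real \<Rightarrow> real) \<Rightarrow> bool" where
  "locally_bounded f \<longleftrightarrow> f \<in> borel_measurable (lebesgue_on {2..}) \<and> (\<forall>X. bounded (f ` {2..X}))"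

lemma locally_boundedI:
  assumes "f \<in> borel_measurable (lebesgue_on {2..})" "\<And>X. \<exists>C. \<forall>x\<in>{2..X}. \<bar>f x\<bar> \<le> C"
  shows "locally_bounded f"
  using assms by (simp add: locally_bounded_def bounded_iff)

lemma locally_bounded_bound:
  "locally_bounded f \<Longrightarrow> \<exists>C. \<forall>x\<in>{2..X}. \<bar>f x\<bar> \<le> C"
  by (simp add: locally_bounded_def bounded_iff)

lemma locally_bounded_add:
  assumes "locally_bounded f" "locally_bounded g"
  shows "locally_bounded (\<lambda>x. f x + g x)"
proof (rule locally_boundedI)
  show "(\<lambda>x. f x + g x) \<in> borel_measurable (lebesgue_on {2..})"
    using assms by (auto simp: locally_bounded_def)
  fix X
  obtain C D where "\<And>x. x \<in> {2..X} \<Longrightarrow> \<bar>f x\<bar> \<le> C" "\<And>x. x \<in> {2..X} \<Longrightarrow> \<bar>g x\<bar> \<le> D"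
    using locally_bounded_bound[OF assms(1), of X] locally_bounded_bound[OF assms(2), of X] by blast
  then show "\<exists>C. \<forall>x\<in>{2..X}. \<bar>f x + g x\<bar> \<le> C"
    by (intro exI[of _ "C + D"]) (force intro: order_trans[OF abs_triangle_ineq] add_mono)
qed

lemma locally_bounded_mult:
  assumes "locally_bounded f" "locally_bounded g"
  shows "locally_bounded (\<lambda>x. f x * g x)"
proof (rule locally_boundedI)
  show "(\<lambda>x. f x * g x) \<in> borel_measurable (lebesgue_on {2..})"
    using assms by (auto simp: locally_bounded_def)
  fix X
  obtain C D where CD: "\<And>x. x \<in> {2..X} \<Longrightarrow> \<bar>f x\<bar> \<le> C" "\<And>x. x \<in> {2..X} \<Longrightarrow> \<bar>g x\<bar> \<le> D"
    using locally_bounded_bound[OF assms(1), of X] locally_bounded_bound[OF assms(2), of X] by blast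
  have "\<bar>f x * g x\<bar> \<le> C * D" if "x \<in> {2..X}" for x
    unfolding abs_mult using CD[OF that] by (intro mult_mono) auto
  then show "\<exists>C. \<forall>x\<in>{2..X}. \<bar>f x * g x\<bar> \<le> C" by blast
qed

lemma locally_bounded_continuous:
  assumes "continuous_on {2..} f"
  shows "locally_bounded f"
  unfolding locally_bounded_def
proof (intro conjI allI)
  show "f \<in> borel_measurable (lebesgue_on {2..})"
    using assms by (intro continuous_imp_measurable_on_sets_lebesgue) auto
  show "bounded (f ` {2..X})" for X
    using continuous_on_subset[OF assms, of "{2..X}"]
    by (intro compact_imp_bounded compact_continuous_image) auto
qed

lemma locally_bounded_diff:
  assumes "locally_bounded f" "locally_bounded g"
  shows "locally_bounded (\<lambda>x. f x - g x)"
proof -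
  have "locally_bounded (\<lambda>x. - 1)" by (intro locally_bounded_continuous continuous_intros)
  from locally_bounded_add[OF assms(1) locally_bounded_mult[OF this assms(2)]] show ?thesis by simp
qed

lemma locally_bounded_prime_pi: "locally_bounded prime_pi"
proof (rule locally_boundedI)
  have "mono prime_pi"
  proof (rule monoI)
    show "prime_pi x \<le> prime_pi y" if "x \<le> y" for x y
      unfolding prime_pi_def using that by (intro of_nat_mono card_mono finite_primes_le) auto
  qed
  then have "prime_pi \<in> borel_measurable borel" by (rule borel_measurable_mono)
  then show "prime_pi \<in> borel_measurable (lebesgue_on {2..})"
    by (intro measurable_restrict_space1 measurable_completion) simp
  show "\<exists>C. \<forall>x\<in>{2..X}. \<bar>prime_pi x\<bar> \<le> C" for X
  proof (intro exI ballI)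
    show "\<bar>prime_pi x\<bar> \<le> X" if "x \<in> {2..X}" for x
      using that prime_pi_le[of x] prime_pi_nonneg[of x] by simp
  qed
qed

text \<open>The real \<open>sqrt\<close> of HOL is odd and increasing on the whole line, so
  monotonicity also covers arguments with a negative radicand.\<close>

lemma nidx_mono: "l \<ge> 1 \<Longrightarrow> x \<le> y \<Longrightarrow> nidx l x \<le> nidx l y"
  unfolding nidx_def \<nu>_def by (intro nat_mono ceiling_mono divide_right_mono) auto

lemma locally_bounded_nidx:
  assumes "l \<ge> 1"
  shows "locally_bounded (\<lambda>x. f (nidx l x))"
proof (rule locally_boundedI)
  have "mono (\<lambda>x. real (nidx l x))" using nidx_mono[OF assms] by (auto simp: mono_def)
  then have "(\<lambda>x. real (nidx l x)) \<in> borel_measurable borel" by (rule borel_measurable_mono)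
  \<comment> \<open>Passing through \<open>nat\<close> of the floor writes an arbitrary f on the
    naturals as a measurable function of a real argument.\<close>
  then have "(\<lambda>x. f (nat \<lfloor>real (nidx l x)\<rfloor>)) \<in> borel_measurable borel" by measurable
  then show "(\<lambda>x. f (nidx l x)) \<in> borel_measurable (lebesgue_on {2..})"
    by (intro measurable_restrict_space1 measurable_completion) simp
  fix X
  have "finite ((\<lambda>n. \<bar>f n\<bar>) ` {..nidx l X})" by simp
  then have "\<bar>f (nidx l x)\<bar> \<le> Max ((\<lambda>n. \<bar>f n\<bar>) ` {..nidx l X})" if "x \<in> {2..X}" for x
    using that nidx_mono[OF assms, of x X] by (intro Max_ge) auto
  then show "\<exists>C. \<forall>x\<in>{2..X}. \<bar>f (nidx l x)\<bar> \<le> C" by blast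
qed

lemma locally_bounded_integrable:
  assumes "locally_bounded f"
  shows "f integrable_on {2..X}"
proof -
  obtain C where C: "\<And>x. x \<in> {2..X} \<Longrightarrow> \<bar>f x\<bar> \<le> C"
    using locally_bounded_bound[OF assms, of X] by blast
  have f: "f \<in> borel_measurable (lebesgue_on {2..X})"
    using assms unfolding locally_bounded_def by (elim conjE measurable_restrict_mono) auto
  show ?thesis
    by (rule measurable_bounded_by_integrable_imp_integrable_real[OF f, where g = "\<lambda>_. C"]) (auto simp: C)
qed

lemma locally_bounded_const: "locally_bounded (\<lambda>x. a)"
  by (intro locally_bounded_continuous continuous_intros)

lemma locally_bounded_id: "locally_bounded (\<lambda>x. x)"
  by (intro locally_bounded_continuous continuous_intros)

lemma locally_bounded_li: "locally_bounded li"
  using antideriv_li unfolding antideriv_def by (intro locally_bounded_continuous) blast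

lemma locally_bounded_inverse: "locally_bounded (\<lambda>x. 1 / x)"
  by (intro locally_bounded_continuous continuous_intros) auto

lemma locally_bounded_ln_sqrt: "locally_bounded (\<lambda>x. ln x / sqrt (2 * x))"
  by (intro locally_bounded_continuous continuous_intros) auto

lemma integrable_E: "(\<lambda>x. E x / x) integrable_on {2..X}"
proof -
  have "locally_bounded (\<lambda>x. ln x / sqrt x)"
    by (intro locally_bounded_continuous continuous_intros) auto
  then have "(\<lambda>x. ln x / sqrt x * (li x - prime_pi x) * (1 / x)) integrable_on {2..X}"
    by (intro locally_bounded_integrable locally_bounded_mult locally_bounded_diff locally_bounded_li
        locally_bounded_prime_pi locally_bounded_inverse)
  then show ?thesis by (simp add: E_def)
qed

subsection \<open>The partition points\<close>

lemma L_step: "n \<ge> 1 \<Longrightarrow> L l n = L l (n - 1) + h l (n - 1)"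
  by (simp add: h_def)

lemma L_strict_mono: "strict_mono (L l)"
proof (rule strict_monoI_Suc)
  show "L l n < L l (Suc n)" for n
    using L_step[of "Suc n" l] h_eq[of l n] by simp (smt (verit) mult_nonneg_nonneg of_nat_0_le_iff)
qed

lemma L_ge: "l \<ge> 1 \<Longrightarrow> real n \<le> L l n"
proof (cases n)
  case (Suc m)
  assume "l \<ge> 1"
  have "real n * 2 \<le> real n * (real l * (real n - 1) + 2)"
    using Suc by (intro mult_left_mono) auto
  then show ?thesis by (simp add: L_def)
qed (simp add: L_def)

lemma nidx_eqI:
  assumes "l \<ge> 1" "x \<ge> 2" "n \<ge> 1" "L l (n - 1) < x" "x \<le> L l n"
  shows "nidx l x = n"
proof -
  note b = L_bracket[OF assms(1,2)]
  have "L l (n - 1) < L l (nidx l x)" "L l (nidx l x - 1) < L l n" using b assms by linarith+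
  then have "n - 1 < nidx l x" "nidx l x - 1 < n" using strict_mono_less[OF L_strict_mono] by blast+
  then show ?thesis using assms(3) by linarith
qed

text \<open>The formulas are required on closed intervals, so that neighbouring pieces agree at the
  shared endpoint and glue to a continuous function. The derivative is claimed only in the
  interiors; the endpoints are locally finite because \<open>L l n\<close> is at least n.\<close>

lemma antideriv_piecewise:
  assumes l: "l \<ge> 1"
    and eq: "\<And>n x. n \<ge> 2 \<Longrightarrow> x \<ge> 2 \<Longrightarrow> L l (n - 1) \<le> x \<Longrightarrow> x \<le> L l n \<Longrightarrow> F x = G n x"
    and der: "\<And>n x. n \<ge> 2 \<Longrightarrow> x \<ge> 2 \<Longrightarrow> (G n has_real_derivative g n x) (at x)"
  shows "antideriv F (\<lambda>x. g (nidx l x) x)"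
proof -
  have contm: "continuous_on {2..L l (Suc m)} F" for m
  proof (induction m)
    case 0
    then show ?case by (simp add: L_def)
  next
    case (Suc m)
    let ?I = "{max 2 (L l (Suc m))..L l (Suc (Suc m))}"
    have "continuous_on ?I (G (Suc (Suc m)))"
      by (intro continuous_at_imp_continuous_on ballI DERIV_isCont[OF der]) auto
    moreover have "F x = G (Suc (Suc m)) x" if "x \<in> ?I" for x
      using that by (intro eq) auto
    ultimately have "continuous_on ?I F" using continuous_on_cong[OF refl, of ?I F] by blast
    then have "continuous_on ({2..L l (Suc m)} \<union> ?I) F"
      using Suc by (intro continuous_on_closed_Un) auto
    then show ?case by (rule continuous_on_subset) auto
  qed
  have cont: "continuous_on {2..X} F" for X
  proof -
    have "X \<le> L l (Suc (nat \<lceil>X\<rceil>))" using L_ge[OF l, of "Suc (nat \<lceil>X\<rceil>)"] by linarith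
    then show ?thesis by (intro continuous_on_subset[OF contm]) auto
  qed
  have fin: "finite (range (L l) \<inter> {2..X})" for X
  proof (rule finite_subset)
    show "range (L l) \<inter> {2..X} \<subseteq> L l ` {..nat \<lfloor>X\<rfloor>}"
    proof
      fix y assume "y \<in> range (L l) \<inter> {2..X}"
      then obtain n where n: "y = L l n" "L l n \<le> X" by auto
      then have "real n \<le> X" using L_ge[OF l, of n] by linarith
      then show "y \<in> L l ` {..nat \<lfloor>X\<rfloor>}" using n by (auto simp: le_nat_floor)
    qed
  qed simp
  have "(F has_real_derivative g (nidx l x) x) (at x)" if x: "x > 2" "x \<notin> range (L l)" for x
  proof -
    define n where "n = nidx l x"
    have n: "n \<ge> 2" "L l (n - 1) < x" "x \<le> L l n" using L_bracket[OF l, of x] x by (auto simp: n_def)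
    then have "x < L l n" using x by (metis less_le rangeI)
    have "(G n has_real_derivative g n x) (at x)" using n x by (intro der) auto
    then show ?thesis unfolding n_def[symmetric]
      by (rule has_field_derivative_transform_within_open[where S = "{max 2 (L l (n - 1))<..<L l n}"])
        (use n x \<open>x < L l n\<close> eq[of n] in auto)
  qed
  then show ?thesis unfolding antideriv_def using fin cont
    by (intro conjI exI[of _ "range (L l)"] continuous_on_atLeastI) auto
qed

definition Lup :: "nat \<Rightarrow> real \<Rightarrow> real" where
  "Lup l x = L l (nidx l x)"

text \<open>The interval with right endpoint \<open>L l n\<close> starts at
  \<open>L l (n - 1)\<close>, hence the shifted index: \<open>Lup l x - gap l x\<close> is the left
  endpoint.\<close>

definition gap :: "nat \<Rightarrow> real \<Rightarrow> real" where
  "gap l x = h l (nidx l x - 1)"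

text \<open>\<open>bump\<close> vanishes at both ends of each interval, so it is continuous, and its derivative
  \<open>slope\<close> is the signed distance to the midpoint, the oscillating part of all error terms below.\<close>

definition bump :: "nat \<Rightarrow> real \<Rightarrow> real" where
  "bump l x = (x - (Lup l x - gap l x)) * (Lup l x - x) / 2"

definition slope :: "nat \<Rightarrow> real \<Rightarrow> real" where
  "slope l x = Lup l x - gap l x / 2 - x"

lemma antideriv_bump:
  assumes l: "l \<ge> 1"
  shows "antideriv (bump l) (slope l)"
proof -
  have "antideriv (bump l) (\<lambda>x. L l (nidx l x) - h l (nidx l x - 1) / 2 - x)"
  proof (rule antideriv_piecewise[OF l])
    fix n x assume n: "n \<ge> 2" and x: "x \<ge> 2" "L l (n - 1) \<le> x" "x \<le> L l n"
    show "bump l x = (x - (L l n - h l (n - 1))) * (L l n - x) / 2"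
    proof (cases "x = L l (n - 1)")
      case False
      then have "nidx l x = n" using n x by (intro nidx_eqI l) auto
      then show ?thesis by (simp add: bump_def Lup_def gap_def)
    next
      \<comment> \<open>At its left endpoint x still belongs to the preceding interval, so
        \<open>nidx\<close> is n - 1 and the preceding parabola is in force; both vanish
        there.\<close>
      case True
      have "L l (n - 1 - 1) < x" unfolding True using n by (intro strict_monoD[OF L_strict_mono]) auto
      then have "nidx l x = n - 1" using n x True by (intro nidx_eqI l) auto
      then show ?thesis using True L_step[of n l] n by (simp add: bump_def Lup_def)
    qed
  next
    fix n :: nat and x :: real
    show "((\<lambda>x. (x - (L l n - h l (n - 1))) * (L l n - x) / 2) has_real_derivative
        L l n - h l (n - 1) / 2 - x) (at x)"
      by (auto intro!: derivative_eq_intros simp: field_simps)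
  qed
  then show ?thesis by (simp add: slope_def[abs_def] Lup_def gap_def)
qed

text \<open>\<open>S_hat\<close> is the piecewise linear interpolation of the sums
  \<open>\<Sigma>s\<close>: on each interval its slope is the value of 1 / ln at the right endpoint.
  It is thus the right-endpoint rule for li, carried on continuously inside the intervals.\<close>

lemma antideriv_S_hat:
  assumes l: "l \<ge> 1"
  shows "antideriv (S_hat l) (\<lambda>x. 1 / ln (Lup l x))"
proof -
  have lin: "((\<lambda>x. a - (b - x) * k) has_real_derivative k) (at x)" for a b k x :: real
    by (auto intro!: derivative_eq_intros)
  have "antideriv (S_hat l) (\<lambda>x. 1 / ln (L l (nidx l x)))"
  proof (rule antideriv_piecewise[OF l])
    fix n x assume n: "n \<ge> 2" and x: "x \<ge> 2" "L l (n - 1) \<le> x" "x \<le> L l n"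
    show "S_hat l x = \<Sigma>s l n - (L l n - x) * (1 / ln (L l n))"
    proof (cases "x = L l (n - 1)")
      case False
      then have "nidx l x = n" using n x by (intro nidx_eqI l) auto
      then show ?thesis by (simp add: S_hat_def)
    next
      \<comment> \<open>As for \<open>bump\<close>, the index at the left endpoint is n - 1; the two
        formulas match because \<open>s l (n - 1)\<close> is the full step divided by ln of its
        right endpoint.\<close>
      case True
      have "L l (n - 1 - 1) < x" unfolding True using n by (intro strict_monoD[OF L_strict_mono]) auto
      then have "nidx l x = n - 1" using n x True by (intro nidx_eqI l) auto
      then have "S_hat l x = \<Sigma>s l (n - 1)" using True by (simp add: S_hat_def)
      moreover obtain k where "n = Suc (Suc k)" using n by (metis Suc_diff_le add_2_eq_Suc le_Suc_ex)
      then have "\<Sigma>s l n = \<Sigma>s l (n - 1) + s l (n - 1)" by (simp add: \<Sigma>s_def)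
      moreover have "s l (n - 1) = (L l n - x) / ln (L l n)"
        using n True L_step[of n l] by (simp add: s_def)
      ultimately show ?thesis by simp
    qed
  next
    fix n :: nat and x :: real
    show "((\<lambda>x. \<Sigma>s l n - (L l n - x) * (1 / ln (L l n))) has_real_derivative 1 / ln (L l n)) (at x)"
      by (rule lin)
  qed
  then show ?thesis by (simp add: Lup_def)
qed

text \<open>The last identity is the central one. Since \<open>slope l x + x\<close> is the midpoint
  of the interval, it says that the squared length equals 2 l times the midpoint plus 1 - l. It is
  exact because the endpoints are quadratic and the lengths linear in the index m of the left
  endpoint.\<close>

lemma Lup_gap:
  assumes l: "l \<ge> 1" and x: "x \<ge> 2"
  shows "x \<le> Lup l x" "Lup l x - gap l x \<le> x" "sqrt x \<le> gap l x" "gap l x \<le> 3 * real l * sqrt x"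
    and "gap l x ^ 2 = 2 * real l * x + 2 * real l * slope l x + 1 - real l"
proof -
  note b = L_bracket[OF l x]
  define m where "m = real (nidx l x) - 1"
  have m: "m \<ge> 1" using b by (simp add: m_def)
  define a where "a = real l"
  have a: "a \<ge> 1" using l by (simp add: a_def)
  have "a * m \<ge> m" using mult_right_mono[of 1 a m] a m by simp
  then have am: "a * m \<ge> m" "a * m \<ge> 1" using m by linarith+
  have H: "gap l x = 1 + a * m" using b by (simp add: gap_def h_eq m_def a_def of_nat_diff)
  have N: "Lup l x = (m + 1) * (a * m + 2) / 2" by (simp add: Lup_def L_def m_def a_def)
  have P: "Lup l x - gap l x = L l (nidx l x - 1)"
    unfolding Lup_def gap_def using b L_step[of "nidx l x" l] by simp
  show "x \<le> Lup l x" "Lup l x - gap l x \<le> x"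
    using b(2,3) unfolding P by (simp_all add: Lup_def)
  have P': "Lup l x - gap l x = m * (a * m - a + 2) / 2" unfolding N H by (simp add: field_simps)
  have mm: "a * m * m \<ge> m * m" using a m by (simp add: mult_mono)
  have "Lup l x \<le> gap l x ^ 2"
  proof -
    \<comment> \<open>Here u and v stand for the products m * t and t * t, which leaves a linear
      claim.\<close>
    have arith: "u \<le> v \<Longrightarrow> 0 \<le> v \<Longrightarrow> m \<le> t \<Longrightarrow> 1 \<le> t \<Longrightarrow> u + t + 2 * m + 2 \<le> 2 + 4 * t + 2 * v" for u v t :: real
      by linarith
    define t where "t = a * m"
    have t: "m \<le> t" "1 \<le> t" using am by (auto simp: t_def)
    have "m * t \<le> t * t" "0 \<le> t * t" using t by (auto intro: mult_right_mono)
    then have "m * t + t + 2 * m + 2 \<le> 2 + 4 * t + 2 * (t * t)" 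
      using t arith by blast
    then show ?thesis unfolding N H t_def[symmetric] by (simp add: field_simps power2_eq_square)
  qed
  then have "sqrt x \<le> sqrt (gap l x ^ 2)" using \<open>x \<le> Lup l x\<close> by (intro real_sqrt_le_mono) linarith
  then show "sqrt x \<le> gap l x" using am unfolding H by simp
  have "m * m \<le> 2 * x"
  proof -
    have "m * m \<le> m * (a * m - a + 2)"
    proof (intro mult_left_mono)
      have "(a - 1) * (m - 1) \<ge> 0" using a m by simp
      then show "m \<le> a * m - a + 2" by (simp add: algebra_simps)
    qed (use m in auto)
    then show ?thesis using \<open>Lup l x - gap l x \<le> x\<close> unfolding P' by linarith
  qed
  \<comment> \<open>As a * m is at least 1, the length 1 + a * m is at most 2 * a * m. Its square is
    then at most 8 a^2 x, and 3 is the next integer above sqrt 8.\<close>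
  have "gap l x ^ 2 \<le> (2 * (a * m)) ^ 2" unfolding H using am by (intro power_mono) auto
  also have "\<dots> = 4 * a ^ 2 * (m * m)" by (simp add: power2_eq_square)
  also have "\<dots> \<le> 4 * a ^ 2 * (2 * x)" using \<open>m * m \<le> 2 * x\<close> by (intro mult_left_mono) auto
  also have "\<dots> \<le> (3 * a * sqrt x) ^ 2" using x by (simp add: power_mult_distrib)
  finally have "gap l x \<le> 3 * a * sqrt x" by (rule power2_le_imp_le) (use a x in auto)
  then show "gap l x \<le> 3 * real l * sqrt x" by (simp add: a_def)
  show "gap l x ^ 2 = 2 * real l * x + 2 * real l * slope l x + 1 - real l"
    unfolding slope_def N H a_def[symmetric] by (simp add: field_simps power2_eq_square)
qed

section \<open>Asymptotic expansions of the integrands\<close>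

lemma bigo_from_2:
  assumes "\<And>x. x \<ge> 2 \<Longrightarrow> \<bar>f x\<bar> \<le> C * g x" "\<And>x. x \<ge> 2 \<Longrightarrow> g x \<ge> 0"
  shows "f \<in> O[at_top](g :: real \<Rightarrow> real)"
proof (rule bigoI)
  show "eventually (\<lambda>x. norm (f x) \<le> C * norm (g x)) at_top"
    using eventually_ge_at_top[of 2]
  proof eventually_elim
    case (elim x)
    show ?case using assms(1)[OF elim] assms(2)[OF elim] by simp
  qed
qed

lemma antideriv_sqrt_ln_cubed:
  "antideriv (\<lambda>x. sqrt x / ln x ^ 3) (\<lambda>x. 1 / (2 * sqrt x * ln x ^ 3) - 3 / (sqrt x * ln x ^ 4))"
  by (rule antideriv_smooth)
    (auto intro!: derivative_eq_intros simp: field_simps eval_nat_numeral)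

text \<open>The parameters stand for \<open>r = \<surd>(2 k x)\<close>, \<open>g = gap\<close>, \<open>d = slope\<close>, \<open>N = Lup\<close>, \<open>a = ln x\<close>,
  \<open>b = ln N\<close>, \<open>c = \<surd>k\<close> with \<open>k = l\<close>. The last five summands are the negligible ones.\<close>

lemma weight_expansion:
  fixes x r g d N a c k :: real
  assumes pos: "x > 0" "r > 0" "g > 0"
    and r: "r ^ 2 = 2 * k * x" and g: "g ^ 2 = 2 * k * x + 2 * k * d + 1 - k" and N: "N - x = d + g / 2"
  shows "c * b / g - a * (c / r) = c / (2 * x) + d * (c / (x * r) * (1 - a / 2))
     + (c * ((b - a - (N - x) / x) * (1 / g)) + c * (d * (r - g) * (1 / (x * r)) * (1 / g))
     + c * ((k - 1) / 2 * (a / r ^ 3)) + c * ((r - g) ^ 2 * (a / (2 * r ^ 3))) + c * ((r - g) ^ 2 * (a / r ^ 2) * (1 / g)))"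
proof -
  \<comment> \<open>The logarithm is linearised, N - x is split into d + g / 2, and in the term with
    d the factor 1/g is replaced by 1/r at the cost of one more product with r - g.\<close>
  have 1: "c * (b - a) / g = c * ((b - a - (N - x) / x) * (1 / g)) + c / (2 * x) + c * d / (x * r) + c * (d * (r - g) * (1 / (x * r)) * (1 / g))"
    unfolding N using pos by (simp add: field_simps)
  \<comment> \<open>An exact second-order expansion of 1/g - 1/r, arranged so that its leading term
    contains r^2 - g^2, which the hypotheses on r and g evaluate.\<close>
  have "(r - g) / (r * g) = (r ^ 2 - g ^ 2) / (2 * r ^ 3) + (r - g) ^ 2 / (2 * r ^ 3) + (r - g) ^ 2 / (r ^ 2 * g)"
    using pos by (simp add: field_simps eval_nat_numeral)
  moreover have "(r ^ 2 - g ^ 2) / (2 * r ^ 3) = (k - 1) / (2 * r ^ 3) - d / (2 * x * r)"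
  proof -
    have "k \<noteq> 0" using r pos by auto
    have "(r ^ 2 - g ^ 2) / (2 * r ^ 3) = (k - 1) / (2 * r ^ 3) - k * d / (r ^ 2 * r)"
    proof -
      have "r ^ 2 - g ^ 2 = k - 1 - 2 * (k * d)" using r g by simp
      then show ?thesis by (simp add: diff_divide_distrib power3_eq_cube power2_eq_square)
    qed
    also have "k * d / (r ^ 2 * r) = d / (2 * x * r)"
      unfolding r using pos \<open>k \<noteq> 0\<close> by (simp add: field_simps)
    finally show ?thesis .
  qed
  ultimately have "1 / g - 1 / r = (k - 1) / (2 * r ^ 3) - d / (2 * x * r) + (r - g) ^ 2 / (2 * r ^ 3) + (r - g) ^ 2 / (r ^ 2 * g)"
    using pos by (simp add: field_simps)
  then have "c * a * (1 / g - 1 / r) = c * a * ((k - 1) / (2 * r ^ 3) - d / (2 * x * r) + (r - g) ^ 2 / (2 * r ^ 3) + (r - g) ^ 2 / (r ^ 2 * g))"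
    by simp
  moreover have "c * b / g - a * (c / r) = c * (b - a) / g + c * a * (1 / g - 1 / r)"
    by (simp add: algebra_simps diff_divide_distrib)
  ultimately show ?thesis unfolding 1 by (simp add: algebra_simps diff_divide_distrib add_divide_distrib)
qed

lemma powr_minus_five_halves:
  fixes x :: real
  assumes "x > 0"
  shows "x powr (- 5 / 2) = 1 / (x ^ 2 * sqrt x)"
proof -
  have "x powr (- 5 / 2) = 1 / x powr (5 / 2)" by (simp add: powr_minus_divide)
  also have "x powr (5 / 2) = x powr 2 * x powr (1 / 2)" using powr_add[of x 2 "1 / 2"] by simp
  also have "\<dots> = x ^ 2 * sqrt x" using assms by (simp add: powr_half_sqrt powr_numeral)
  finally show ?thesis .
qed

text \<open>The factor of \<open>slope\<close> in \<open>weight_expansion\<close>, divided by \<open>x\<close>.\<close>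

definition osc :: "real \<Rightarrow> real" where
  "osc x = (1 - ln x / 2) / sqrt 2 * x powr (- 5 / 2)"

definition osc' :: "real \<Rightarrow> real" where
  "osc' x = (5 / 4 * ln x - 3) / sqrt 2 * x powr (- 7 / 2)"

lemma antideriv_osc: "antideriv osc osc'"
proof (rule antideriv_smooth)
  fix x :: real assume x: "x \<ge> 2"
  have p: "x powr (- 5 / 2) = x powr (- 7 / 2) * x"
    using powr_add[of x "- 7 / 2" 1] x by simp
  have "((\<lambda>x. (1 - ln x / 2) * k * x powr (- 5 / 2)) has_real_derivative
      (- (1 / (2 * x)) * k * x powr (- 5 / 2) + (1 - ln x / 2) * k * (- 5 / 2 * x powr (- 5 / 2 - 1)))) (at x)" for k
    using x by (auto intro!: derivative_eq_intros simp: field_simps)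
  from this[of "1 / sqrt 2"]
  have "(osc has_real_derivative (- (1 / (2 * x)) * (1 / sqrt 2) * x powr (- 5 / 2)
      + (1 - ln x / 2) * (1 / sqrt 2) * (- 5 / 2 * x powr (- 5 / 2 - 1)))) (at x)"
    unfolding osc_def[abs_def] by simp
  also have "- 5 / 2 - 1 = (- 7 / 2 :: real)" by simp
  also have "- (1 / (2 * x)) * (1 / sqrt 2) * x powr (- 5 / 2)
      + (1 - ln x / 2) * (1 / sqrt 2) * (- 5 / 2 * x powr (- 7 / 2)) = osc' x"
    unfolding p osc'_def using x by (simp add: field_simps)
  finally show "(osc has_real_derivative osc' x) (at x)" .
qed

lemma locally_bounded_osc: "locally_bounded osc" "locally_bounded osc'"
  unfolding osc_def[abs_def] osc'_def[abs_def]
  by (intro locally_bounded_continuous continuous_intros; force)+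

context
  fixes l :: nat
  assumes l: "l \<ge> 1"
begin

lemma gap_pos: "x \<ge> 2 \<Longrightarrow> gap l x > 0"
  using Lup_gap(3)[OF l, of x] real_sqrt_gt_zero[of x] by linarith

lemma gap_bigo: "gap l \<in> O(\<lambda>x. sqrt x)"
proof (rule bigo_from_2[of _ "3 * real l"])
  show "\<bar>gap l x\<bar> \<le> 3 * real l * sqrt x" if "x \<ge> 2" for x
    using Lup_gap(4)[OF l that] gap_pos[OF that] by linarith
qed auto

lemma inverse_gap_bigo: "(\<lambda>x. 1 / gap l x) \<in> O(\<lambda>x. 1 / sqrt x)"
proof (rule bigo_from_2[of _ 1])
  show "\<bar>1 / gap l x\<bar> \<le> 1 * (1 / sqrt x)" if "x \<ge> 2" for x
    using Lup_gap(3)[OF l that] gap_pos[OF that] that by (simp add: frac_le)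
qed auto

lemma Lup_diff_bigo: "(\<lambda>x. Lup l x - x) \<in> O(\<lambda>x. sqrt x)"
proof (rule bigo_from_2[of _ "3 * real l"])
  show "\<bar>Lup l x - x\<bar> \<le> 3 * real l * sqrt x" if "x \<ge> 2" for x
    using Lup_gap[OF l that] by linarith
qed auto

lemma slope_bigo: "slope l \<in> O(\<lambda>x. sqrt x)"
proof (rule bigo_from_2[of _ "3 * real l"])
  show "\<bar>slope l x\<bar> \<le> 3 * real l * sqrt x" if "x \<ge> 2" for x
    using Lup_gap(1-4)[OF l that] unfolding slope_def by linarith
qed auto

lemma bump_bigo: "bump l \<in> O(\<lambda>x. x)"
proof -
  have "(\<lambda>x. gap l x - (Lup l x - x)) \<in> O(\<lambda>x. sqrt x)"
    by (intro sum_in_bigo gap_bigo Lup_diff_bigo)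
  then have "(\<lambda>x. (gap l x - (Lup l x - x)) * (Lup l x - x)) \<in> O(\<lambda>x. sqrt x * sqrt x)"
    using Lup_diff_bigo by (rule landau_o.big.mult)
  also have "(\<lambda>x. sqrt x * sqrt x) \<in> O(\<lambda>x :: real. x)" by real_asymp
  finally have "(\<lambda>x. (gap l x - (Lup l x - x)) * (Lup l x - x)) \<in> O(\<lambda>x. x)" .
  then show ?thesis unfolding bump_def[abs_def] by (simp add: algebra_simps)
qed

text \<open>By the identity for the squared length, r^2 - gap^2 is a combination of
  \<open>slope\<close> and a constant. It is at most 3 l gap in absolute value, 2 l gap from the
  slope and l gap from the constant; division by r + gap leaves O(1).\<close>

lemma gap_approx: "(\<lambda>x. sqrt (2 * real l * x) - gap l x) \<in> O(\<lambda>_. 1)"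
proof (rule bigo_from_2[of _ "4 * real l"])
  fix x :: real assume x: "x \<ge> 2"
  note g = Lup_gap[OF l x]
  define r where "r = sqrt (2 * real l * x)"
  have r: "r \<ge> 0" "r ^ 2 = 2 * real l * x" using x by (auto simp: r_def)
  have "1 \<le> sqrt x" using x by simp
  then have g1: "gap l x \<ge> 1" using g(3) by linarith
  have "\<bar>slope l x\<bar> \<le> gap l x" using g(1,2) gap_pos[OF x] unfolding slope_def by linarith
  then have "\<bar>2 * real l * slope l x\<bar> \<le> 2 * real l * gap l x" by (simp add: abs_mult mult_left_mono)
  moreover have "real l \<le> real l * gap l x" using g1 mult_left_mono[of 1 "gap l x" "real l"] by simp
  moreover have "real l \<ge> 1" using l by simp
  ultimately have "\<bar>r ^ 2 - gap l x ^ 2\<bar> \<le> 3 * (real l * gap l x)"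
    unfolding r(2) g(5) by linarith
  also have "\<dots> \<le> 4 * real l * (r + gap l x)" using r g1 l by (simp add: algebra_simps)
  finally have "\<bar>r - gap l x\<bar> * (r + gap l x) \<le> 4 * real l * (r + gap l x)"
    using r g1 abs_mult[of "r - gap l x" "r + gap l x"] by (simp add: power2_eq_square square_diff_square_factored mult.commute)
  then show "\<bar>sqrt (2 * real l * x) - gap l x\<bar> \<le> 4 * real l * 1"
    using r g1 unfolding r_def[symmetric] by (simp add: mult_le_cancel_right)
qed auto

text \<open>With u = (Lup - x) / x this is ln(1 + u) = u + O(u^2), and u is O(1 / sqrt x). The lower
  bound uses that u - u^2 is at most u / (1 + u).\<close>

lemma ln_Lup_approx: "(\<lambda>x. ln (Lup l x) - ln x - (Lup l x - x) / x) \<in> O(\<lambda>x. 1 / x)"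
proof -
  have "(\<lambda>x. ln (Lup l x) - ln x - (Lup l x - x) / x) \<in> O(\<lambda>x. ((Lup l x - x) / x) ^ 2)"
  proof (rule bigo_from_2[of _ 1])
    fix x :: real assume x: "x \<ge> 2"
    define u where "u = (Lup l x - x) / x"
    have u: "u \<ge> 0" using x Lup_gap(1)[OF l x] by (simp add: u_def)
    have "ln (Lup l x) - ln x = ln (1 + u)"
      using x Lup_gap(1)[OF l x] by (simp add: u_def ln_divide_pos[symmetric] diff_divide_distrib)
    moreover have "ln (1 + u) \<le> u" using u by (rule ln_add_one_self_le_self)
    moreover have "u - u ^ 2 \<le> ln (1 + u)"
    proof -
      have "ln (1 / (1 + u)) \<le> 1 / (1 + u) - 1" using u by (intro ln_le_minus_one) auto
      then have "1 - 1 / (1 + u) \<le> ln (1 + u)" using u by (simp add: ln_div)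
      moreover have "(u - u ^ 2) * (1 + u) \<le> u" using u by (simp add: algebra_simps power2_eq_square)
      then have "u - u ^ 2 \<le> u / (1 + u)" using u by (simp add: le_divide_eq)
      moreover have "u / (1 + u) = 1 - 1 / (1 + u)" using u by (simp add: field_simps)
      ultimately show ?thesis by linarith
    qed
    ultimately show "\<bar>ln (Lup l x) - ln x - (Lup l x - x) / x\<bar> \<le> 1 * ((Lup l x - x) / x) ^ 2"
      unfolding u_def[symmetric] by auto
  qed auto
  also have "(\<lambda>x. ((Lup l x - x) / x) ^ 2) \<in> O(\<lambda>x. (sqrt x / x) ^ 2)"
    by (intro landau_o.big_power landau_o.big.divide_right Lup_diff_bigo)
      (auto intro: eventually_mono[OF eventually_gt_at_top[of 0]])
  also have "(\<lambda>x. (sqrt x / x) ^ 2) \<in> O(\<lambda>x :: real. 1 / x)" by real_asymp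
  finally show ?thesis .
qed

lemma ln_Lup_diff_bigo: "(\<lambda>x. ln (Lup l x) - ln x) \<in> O(\<lambda>x. 1 / sqrt x)"
proof -
  have "(\<lambda>x. (Lup l x - x) / x) \<in> O(\<lambda>x. sqrt x / x)"
    by (intro landau_o.big.divide_right Lup_diff_bigo)
      (auto intro: eventually_mono[OF eventually_gt_at_top[of 0]])
  also have "(\<lambda>x. sqrt x / x) \<in> O(\<lambda>x :: real. 1 / sqrt x)" by real_asymp
  finally have 1: "(\<lambda>x. (Lup l x - x) / x) \<in> O(\<lambda>x. 1 / sqrt x)" .
  have "(\<lambda>x :: real. 1 / x) \<in> O(\<lambda>x. 1 / sqrt x)" by real_asymp
  with ln_Lup_approx have 2: "(\<lambda>x. ln (Lup l x) - ln x - (Lup l x - x) / x) \<in> O(\<lambda>x. 1 / sqrt x)"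
    by (rule landau_o.big_trans)
  from sum_in_bigo(1)[OF 2 1] show ?thesis by simp
qed

lemma inverse_ln_Lup_bigo: "(\<lambda>x. 1 / ln (Lup l x)) \<in> O(\<lambda>x. 1 / ln x)"
proof (rule bigo_from_2[of _ 1])
  fix x :: real assume x: "x \<ge> 2"
  then have "0 < ln x" "ln x \<le> ln (Lup l x)" using Lup_gap(1)[OF l x] by auto
  then show "\<bar>1 / ln (Lup l x)\<bar> \<le> 1 * (1 / ln x)" by (simp add: frac_le)
qed auto

text \<open>The derivative 1 / ln Lup - 1 / ln x is about -(Lup - x) / (x (ln x)^2), and Lup - x is
  gap / 2 plus \<open>slope\<close>. The part with gap / 2 is cancelled to leading order by the
  derivative of the explicit main term, the oscillating part by that of \<open>bump\<close> times
  \<open>?\<psi>\<close>. The corrected function \<open>?G\<close> then has a derivative small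
  enough to be compared with that of sqrt x / (ln x)^3.\<close>

lemma S_hat_li_bigo:
  "(\<lambda>x. S_hat l x - li x + sqrt (2 * real l) * (sqrt x / ln x ^ 2)) \<in> O(\<lambda>x. sqrt x / ln x ^ 3)"
proof -
  let ?c = "sqrt (2 * real l)"
  let ?\<psi> = "\<lambda>x :: real. 1 / (x * ln x ^ 2)"
  let ?\<psi>' = "\<lambda>x :: real. - (ln x + 2) / (x ^ 2 * ln x ^ 3)"
  let ?G = "\<lambda>x. S_hat l x + (- 1) * li x + ?c * (sqrt x / ln x ^ 2) + bump l x * ?\<psi> x"
  \<comment> \<open>The summands with factor 0 are those that the product rule yields for constant
    factors; they are kept so that the rules for \<open>antideriv\<close> apply literally.\<close>
  let ?g = "\<lambda>x. 1 / ln (Lup l x) + (0 * li x + (- 1) * (1 / ln x)) +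
      (0 * (sqrt x / ln x ^ 2) + ?c * (1 / (2 * sqrt x * ln x ^ 2) - 2 / (sqrt x * ln x ^ 3))) +
      (slope l x * ?\<psi> x + bump l x * ?\<psi>' x)"
  have a\<psi>: "antideriv ?\<psi> ?\<psi>'"
    by (rule antideriv_smooth) (auto intro!: derivative_eq_intros simp: field_simps eval_nat_numeral)
  have asq: "antideriv (\<lambda>x. sqrt x / ln x ^ 2) (\<lambda>x. 1 / (2 * sqrt x * ln x ^ 2) - 2 / (sqrt x * ln x ^ 3))"
    by (rule antideriv_smooth)
      (auto intro!: derivative_eq_intros simp: field_simps eval_nat_numeral)
  have aconst: "antideriv (\<lambda>_. c) (\<lambda>_. 0)" for c
    by (rule antideriv_smooth) auto
  have aG: "antideriv ?G ?g"
    by (intro antideriv_add antideriv_mult antideriv_S_hat antideriv_li antideriv_bump asq a\<psi> aconst l)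
  let ?\<delta> = "\<lambda>x. ln (Lup l x) - ln x"
  let ?e1 = "\<lambda>x. ln (Lup l x) - ln x - (Lup l x - x) / x"
  let ?e2 = "\<lambda>x. sqrt (2 * real l * x) - gap l x"
  let ?k = "\<lambda>x :: real. 1 / (sqrt x * ln x ^ 3)"
  \<comment> \<open>What survives the two cancellations. Only the term \<open>2 * ?c * ?k\<close>,
    the lower-order part of the derivative of the main term, has the full size of \<open>?k\<close>;
    the others are smaller by about sqrt x up to logarithms.\<close>
  let ?g' = "\<lambda>x. ?\<delta> x ^ 2 * (1 / ln (Lup l x)) * (1 / ln x ^ 2) - ?e1 x * (1 / ln x ^ 2) + ?e2 x * (1 / (2 * x * ln x ^ 2))
      - 2 * ?c * ?k x + bump l x * ?\<psi>' x"
  have eq: "?g' x = ?g x" if x: "x \<ge> 2" for x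
  proof -
    define a where "a = ln x"
    define b where "b = ln (Lup l x)"
    have ab: "a > 0" "b > 0" using x Lup_gap(1)[OF l x] by (auto simp: a_def b_def)
    have sx: "sqrt (2 * real l * x) = ?c * sqrt x" by (simp add: real_sqrt_mult)
    have s2: "sqrt x / x = 1 / sqrt x" using x by (simp add: real_div_sqrt field_simps)
    have "1 / b - 1 / a = (b - a) ^ 2 * (1 / b) * (1 / a ^ 2) - (b - a) * (1 / a ^ 2)"
      using ab by (simp add: field_simps power2_eq_square)
    moreover have "?c * sqrt x * (1 / (2 * x * a ^ 2)) = ?c * (1 / (2 * sqrt x * a ^ 2))"
      using x ab s2 by (simp add: field_simps)
    ultimately show ?thesis
      unfolding slope_def sx a_def[symmetric] b_def[symmetric]
      using x ab by (simp add: algebra_simps diff_divide_distrib add_divide_distrib)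
  qed
  have k_weaken: "f \<in> O(?k)" if "f \<in> O(g)" "g \<in> O(?k)" for f g
    using that by (rule landau_o.big_trans)
  have t1: "(\<lambda>x. ?\<delta> x ^ 2 * (1 / ln (Lup l x)) * (1 / ln x ^ 2)) \<in> O(?k)"
  proof (rule k_weaken)
    show "(\<lambda>x. ?\<delta> x ^ 2 * (1 / ln (Lup l x)) * (1 / ln x ^ 2)) \<in> O(\<lambda>x. (1 / sqrt x) ^ 2 * (1 / ln x) * (1 / ln x ^ 2))"
      by (intro landau_o.big.mult landau_o.big_power ln_Lup_diff_bigo inverse_ln_Lup_bigo l landau_o.big_refl)
  qed real_asymp
  have t2: "(\<lambda>x. ?e1 x * (1 / ln x ^ 2)) \<in> O(?k)"
  proof (rule k_weaken)
    show "(\<lambda>x. ?e1 x * (1 / ln x ^ 2)) \<in> O(\<lambda>x. 1 / x * (1 / ln x ^ 2))"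
      by (intro landau_o.big.mult ln_Lup_approx l landau_o.big_refl)
  qed real_asymp
  have t3: "(\<lambda>x. ?e2 x * (1 / (2 * x * ln x ^ 2))) \<in> O(?k)"
  proof (rule k_weaken)
    show "(\<lambda>x. ?e2 x * (1 / (2 * x * ln x ^ 2))) \<in> O(\<lambda>x. 1 * (1 / (2 * x * ln x ^ 2)))"
      by (intro landau_o.big.mult gap_approx l landau_o.big_refl)
  qed real_asymp
  have t4: "(\<lambda>x. 2 * ?c * ?k x) \<in> O(?k)"
    by (rule bigoI[of _ "2 * ?c"]) (simp add: abs_mult)
  have t5: "(\<lambda>x. bump l x * ?\<psi>' x) \<in> O(?k)"
  proof (rule k_weaken)
    show "(\<lambda>x. bump l x * ?\<psi>' x) \<in> O(\<lambda>x. x * ?\<psi>' x)"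
      by (intro landau_o.big.mult bump_bigo l landau_o.big_refl)
  qed real_asymp
  have "?g' \<in> O(?k)"
    using sum_in_bigo(1)[OF sum_in_bigo(2)[OF sum_in_bigo(1)[OF sum_in_bigo(2)[OF t1 t2] t3] t4] t5] .
  then have "?g \<in> O(?k)"
    by (rule bigo_eventually_eq) (rule eventually_mono[OF eventually_ge_at_top[of 2] eq])
  moreover have "?k \<in> O(\<lambda>x. 1 / (2 * sqrt x * ln x ^ 3) - 3 / (sqrt x * ln x ^ 4))"
    by real_asymp
  ultimately have "?g \<in> O(\<lambda>x. 1 / (2 * sqrt x * ln x ^ 3) - 3 / (sqrt x * ln x ^ 4))"
    by (rule landau_o.big_trans)
  then have G: "?G \<in> O(\<lambda>x. sqrt x / ln x ^ 3)"
  proof (rule antideriv_bigo[OF aG antideriv_sqrt_ln_cubed])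
    show "eventually (\<lambda>x :: real. 0 \<le> 1 / (2 * sqrt x * ln x ^ 3) - 3 / (sqrt x * ln x ^ 4)) at_top"
      by real_asymp
    show "filterlim (\<lambda>x :: real. sqrt x / ln x ^ 3) at_top at_top" by real_asymp
  qed
  have "(\<lambda>x. bump l x * ?\<psi> x) \<in> O(\<lambda>x. x * ?\<psi> x)"
    by (intro landau_o.big.mult bump_bigo l landau_o.big_refl)
  also have "(\<lambda>x :: real. x * ?\<psi> x) \<in> O(\<lambda>x. sqrt x / ln x ^ 3)" by real_asymp
  finally have "(\<lambda>x. bump l x * ?\<psi> x) \<in> O(\<lambda>x. sqrt x / ln x ^ 3)" .
  from sum_in_bigo(2)[OF G this] show ?thesis by simp
qed

text \<open>The function w of the overview: the discrepancy between the normalisations of Z and of E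
  / sqrt 2, each divided by x.\<close>

definition weight :: "real \<Rightarrow> real" where
  "weight x = (1 / q l x - ln x / sqrt (2 * x)) / x"

lemma inverse_q: "1 / q l x = sqrt (real l) * ln (Lup l x) / gap l x"
  by (simp add: q_def Lup_def gap_def)

lemma weight_eq:
  assumes x: "x \<ge> 2"
  shows "x * weight x = sqrt (real l) * ln (Lup l x) / gap l x - ln x * (sqrt (real l) / sqrt (2 * real l * x))"
proof -
  have "sqrt (real l) / sqrt (2 * real l * x) = 1 / sqrt (2 * x)"
    using l x by (simp add: real_sqrt_mult field_simps)
  then show ?thesis using x by (simp add: weight_def inverse_q)
qed

text \<open>After \<open>weight_expansion\<close>, each negligible summand is O(ln x / x^(3/2)),
  since r - gap is bounded, \<open>slope\<close> is O(sqrt x) and ln Lup is linear in Lup - x up to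
  O(1 / x). A further division by x gives the claim.\<close>

lemma weight_remainder:
  "(\<lambda>x. weight x - sqrt (real l) / 2 * (1 / x ^ 2) - (slope l x * osc x + bump l x * osc' x)) \<in> O(\<lambda>x. ln x * x powr (- 5 / 2))"
proof -
  define c where "c = sqrt (real l)"
  define r where "r = (\<lambda>x. sqrt (2 * real l * x))"
  let ?k = "\<lambda>x :: real. ln x * x powr (- 5 / 2)"
  let ?e1 = "\<lambda>x. ln (Lup l x) - ln x - (Lup l x - x) / x"
  let ?e2 = "\<lambda>x. r x - gap l x"
  let ?R = "\<lambda>x. c * (?e1 x * (1 / gap l x)) + c * (slope l x * ?e2 x * (1 / (x * r x)) * (1 / gap l x))
     + c * ((real l - 1) / 2 * (ln x / r x ^ 3)) + c * (?e2 x ^ 2 * (ln x / (2 * r x ^ 3))) + c * (?e2 x ^ 2 * (ln x / r x ^ 2) * (1 / gap l x))"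
  let ?w = "\<lambda>x :: real. ln x * x powr (- 3 / 2)"
  have l0: "real l > 0" using l by simp
  have e2: "?e2 \<in> O(\<lambda>_. 1)" unfolding r_def by (rule gap_approx)
  have cm: "(\<lambda>x. a * f x) \<in> O(?w)" if "f \<in> O(?w)" for f and a :: real
    using that by (cases "a = 0") auto
  have weaken: "f \<in> O(?w)" if "f \<in> O(g)" "g \<in> O(?w)" for f g
    using that by (rule landau_o.big_trans)
  have t1: "(\<lambda>x. ?e1 x * (1 / gap l x)) \<in> O(?w)"
  proof (rule weaken)
    show "(\<lambda>x. ?e1 x * (1 / gap l x)) \<in> O(\<lambda>x. 1 / x * (1 / sqrt x))"
      by (intro landau_o.big.mult ln_Lup_approx inverse_gap_bigo l)
  qed real_asymp
  have t2: "(\<lambda>x. slope l x * ?e2 x * (1 / (x * r x)) * (1 / gap l x)) \<in> O(?w)"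
  proof (rule weaken)
    show "(\<lambda>x. slope l x * ?e2 x * (1 / (x * r x)) * (1 / gap l x)) \<in> O(\<lambda>x. sqrt x * 1 * (1 / (x * r x)) * (1 / sqrt x))"
      by (intro landau_o.big.mult slope_bigo e2 inverse_gap_bigo l landau_o.big_refl)
    show "(\<lambda>x. sqrt x * 1 * (1 / (x * r x)) * (1 / sqrt x)) \<in> O(?w)"
      unfolding r_def using l0 by real_asymp
  qed
  have t3: "(\<lambda>x. ln x / r x ^ 3) \<in> O(?w)" unfolding r_def using l0 by real_asymp
  have t4: "(\<lambda>x. ?e2 x ^ 2 * (ln x / (2 * r x ^ 3))) \<in> O(?w)"
  proof (rule weaken)
    show "(\<lambda>x. ?e2 x ^ 2 * (ln x / (2 * r x ^ 3))) \<in> O(\<lambda>x. 1 ^ 2 * (ln x / (2 * r x ^ 3)))"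
      by (intro landau_o.big.mult landau_o.big_power e2 landau_o.big_refl)
    show "(\<lambda>x. 1 ^ 2 * (ln x / (2 * r x ^ 3))) \<in> O(?w)"
      unfolding r_def using l0 by real_asymp
  qed
  have t5: "(\<lambda>x. ?e2 x ^ 2 * (ln x / r x ^ 2) * (1 / gap l x)) \<in> O(?w)"
  proof (rule weaken)
    show "(\<lambda>x. ?e2 x ^ 2 * (ln x / r x ^ 2) * (1 / gap l x)) \<in> O(\<lambda>x. 1 ^ 2 * (ln x / r x ^ 2) * (1 / sqrt x))"
      by (intro landau_o.big.mult landau_o.big_power e2 inverse_gap_bigo l landau_o.big_refl)
    show "(\<lambda>x. 1 ^ 2 * (ln x / r x ^ 2) * (1 / sqrt x)) \<in> O(?w)"
      unfolding r_def using l0 by real_asymp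
  qed
  have "?R \<in> O(?w)"
    by (rule sum_in_bigo(1)[OF sum_in_bigo(1)[OF sum_in_bigo(1)[OF sum_in_bigo(1)[OF cm[OF t1] cm[OF t2]] cm[OF cm[OF t3]]] cm[OF t4]] cm[OF t5]])
  then have "(\<lambda>x. ?R x * (1 / x)) \<in> O(\<lambda>x. ?w x * (1 / x))"
    by (intro landau_o.big.mult landau_o.big_refl)
  also have "(\<lambda>x. ?w x * (1 / x)) \<in> O(?k)" by real_asymp
  finally have R: "(\<lambda>x. ?R x * (1 / x)) \<in> O(?k)" .
  \<comment> \<open>This term completes \<open>slope l x * osc x\<close> to the full derivative of
    \<open>bump l x * osc x\<close>, and is itself of the order of the remainder.\<close>
  have "(\<lambda>x. bump l x * osc' x) \<in> O(\<lambda>x. x * osc' x)"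
    by (intro landau_o.big.mult bump_bigo l landau_o.big_refl)
  also have "(\<lambda>x. x * osc' x) \<in> O(?k)" unfolding osc'_def by real_asymp
  finally have B: "(\<lambda>x. bump l x * osc' x) \<in> O(?k)" .
  have "(\<lambda>x. ?R x * (1 / x) - bump l x * osc' x) \<in> O(?k)"
    by (rule sum_in_bigo(2)[OF R B])
  then show ?thesis
  proof (rule bigo_eventually_eq)
    show "eventually (\<lambda>x. ?R x * (1 / x) - bump l x * osc' x =
        weight x - sqrt (real l) / 2 * (1 / x ^ 2) - (slope l x * osc x + bump l x * osc' x)) at_top"
      using eventually_ge_at_top[of 2]
    proof eventually_elim
      case (elim x)
      have rr: "sqrt (2 * real l * x) = r x" by (simp add: r_def)
      have rx: "r x > 0" "r x ^ 2 = 2 * real l * x" using elim l0 by (auto simp: r_def)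
      have x0: "x > 0" using elim by simp
      have up: "Lup l x - x = slope l x + gap l x / 2" by (simp add: slope_def)
      have "x * weight x = c / (2 * x) + slope l x * (c / (x * r x) * (1 - ln x / 2)) + ?R x"
        unfolding weight_eq[OF elim] c_def[symmetric] rr
        by (rule weight_expansion[OF x0 rx(1) gap_pos[OF elim] rx(2) Lup_gap(5)[OF l elim] up])
      moreover have "x * osc x = c / (x * r x) * (1 - ln x / 2)"
      proof -
        have p: "x powr (- 5 / 2) = 1 / (x ^ 2 * sqrt x)" using x0 by (rule powr_minus_five_halves)
        \<comment> \<open>The factor sqrt l of c cancels against that of r, so \<open>osc\<close> is
          independent of l.\<close>
        have rf: "r x = sqrt 2 * c * sqrt x" by (simp add: r_def c_def real_sqrt_mult)
        have "c > 0" using l0 by (simp add: c_def)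
        then show ?thesis unfolding osc_def p rf using x0 by (simp add: field_simps power2_eq_square)
      qed
      ultimately have "x * weight x = c / (2 * x) + slope l x * (x * osc x) + ?R x" by simp
      then have "weight x = c / 2 * (1 / x ^ 2) + slope l x * osc x + ?R x * (1 / x)"
        using elim by (simp add: field_simps power2_eq_square)
      then show ?case by (simp add: c_def)
    qed
  qed
qed

section \<open>The two summands of the difference and their logarithmic means\<close>

lemma locally_bounded_inverse_q: "locally_bounded (\<lambda>x. 1 / q l x)"
  unfolding q_def by (rule locally_bounded_nidx[OF l])

lemma locally_bounded_S_hat: "locally_bounded (S_hat l)"
  using antideriv_S_hat[OF l] unfolding antideriv_def by (intro locally_bounded_continuous) blast

lemma locally_bounded_bump: "locally_bounded (bump l)"
  using antideriv_bump[OF l] unfolding antideriv_def by (intro locally_bounded_continuous) blast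

lemma locally_bounded_slope: "locally_bounded (slope l)"
proof -
  have "slope l = (\<lambda>x. (L l (nidx l x) - h l (nidx l x - 1) / 2) - x)"
    by (simp add: slope_def[abs_def] Lup_def gap_def)
  then show ?thesis
    using locally_bounded_diff[OF locally_bounded_nidx[OF l, of "\<lambda>n. L l n - h l (n - 1) / 2"] locally_bounded_id] by simp
qed

lemma locally_bounded_weight: "locally_bounded weight"
proof -
  have "locally_bounded (\<lambda>x. (1 / q l x - ln x / sqrt (2 * x)) * (1 / x))"
    by (intro locally_bounded_mult locally_bounded_diff locally_bounded_inverse_q
        locally_bounded_ln_sqrt locally_bounded_inverse)
  then show ?thesis by (simp add: weight_def[abs_def])
qed

lemma weight_bigo: "weight \<in> O(\<lambda>x. ln x / x ^ 2)"
proof -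
  let ?k = "\<lambda>x :: real. ln x / x ^ 2"
  have "(\<lambda>x. slope l x * osc x) \<in> O(\<lambda>x. sqrt x * osc x)"
    by (intro landau_o.big.mult slope_bigo l landau_o.big_refl)
  also have "(\<lambda>x. sqrt x * osc x) \<in> O(?k)" unfolding osc_def by real_asymp
  finally have 1: "(\<lambda>x. slope l x * osc x) \<in> O(?k)" .
  have "(\<lambda>x. bump l x * osc' x) \<in> O(\<lambda>x. x * osc' x)"
    by (intro landau_o.big.mult bump_bigo l landau_o.big_refl)
  also have "(\<lambda>x. x * osc' x) \<in> O(?k)" unfolding osc'_def by real_asymp
  finally have 2: "(\<lambda>x. bump l x * osc' x) \<in> O(?k)" .
  have 3: "(\<lambda>x. sqrt (real l) / 2 * (1 / x ^ 2)) \<in> O(?k)" by real_asymp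
  have "(\<lambda>x :: real. ln x * x powr (- 5 / 2)) \<in> O(?k)" by real_asymp
  with weight_remainder
  have 4: "(\<lambda>x. weight x - sqrt (real l) / 2 * (1 / x ^ 2) - (slope l x * osc x + bump l x * osc' x)) \<in> O(?k)"
    by (rule landau_o.big_trans)
  from sum_in_bigo(1)[OF sum_in_bigo(1)[OF 4 3] sum_in_bigo(1)[OF 1 2]] show ?thesis by simp
qed

text \<open>Split \<open>S_hat\<close> - li into its main term and the error \<open>?D\<close>, and
  1 / (q x) into \<open>weight\<close> and ln x / (sqrt(2 x) x). Of the four products only that of
  the two main parts exceeds O(1 / (x (ln x)^2)); it is - sqrt l / (x ln x), which the added term
  cancels. The product of \<open>?D\<close> with the second factor has exactly the critical order,
  so the cube of ln x in \<open>S_hat_li_bigo\<close> is what makes it integrable.\<close>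

lemma bounded_integral_S_hat_li:
  "bounded_integral (\<lambda>x. (S_hat l x - li x) * (1 / q l x) * (1 / x) + sqrt (real l) * (1 / (x * ln x)))"
proof (rule bounded_integral_bigo)
  have "locally_bounded (\<lambda>x. 1 / (x * ln x))"
    by (intro locally_bounded_continuous continuous_intros) auto
  then show "(\<lambda>x. (S_hat l x - li x) * (1 / q l x) * (1 / x) + sqrt (real l) * (1 / (x * ln x))) integrable_on {2..X}" for X
    by (intro locally_bounded_integrable locally_bounded_add locally_bounded_mult locally_bounded_diff
        locally_bounded_S_hat locally_bounded_li locally_bounded_inverse_q locally_bounded_inverse
        locally_bounded_const)
  let ?k = "\<lambda>x :: real. 1 / (x * ln x ^ 2)"
  let ?c = "sqrt (2 * real l)"
  let ?D = "\<lambda>x. S_hat l x - li x + ?c * (sqrt x / ln x ^ 2)"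
  have 1: "(\<lambda>x. ?D x * weight x) \<in> O(?k)"
    by (rule landau_o.big_trans[OF landau_o.big.mult[OF S_hat_li_bigo weight_bigo]]) real_asymp
  have 2: "(\<lambda>x. ?D x * (ln x / sqrt (2 * x) * (1 / x))) \<in> O(?k)"
    by (rule landau_o.big_trans[OF landau_o.big.mult[OF S_hat_li_bigo landau_o.big_refl]]) real_asymp
  have 3: "(\<lambda>x. ?c * (sqrt x / ln x ^ 2) * weight x) \<in> O(?k)"
    by (rule landau_o.big_trans[OF landau_o.big.mult[OF landau_o.big_refl weight_bigo]]) real_asymp
  have "(\<lambda>x. ?D x * weight x + ?D x * (ln x / sqrt (2 * x) * (1 / x)) - ?c * (sqrt x / ln x ^ 2) * weight x) \<in> O(?k)"
    by (rule sum_in_bigo(2)[OF sum_in_bigo(1)[OF 1 2] 3])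
  then show "(\<lambda>x. (S_hat l x - li x) * (1 / q l x) * (1 / x) + sqrt (real l) * (1 / (x * ln x))) \<in> O(?k)"
  proof (rule bigo_eventually_eq)
    show "eventually (\<lambda>x. ?D x * weight x + ?D x * (ln x / sqrt (2 * x) * (1 / x)) - ?c * (sqrt x / ln x ^ 2) * weight x =
        (S_hat l x - li x) * (1 / q l x) * (1 / x) + sqrt (real l) * (1 / (x * ln x))) at_top"
      using eventually_ge_at_top[of 2]
    proof eventually_elim
      case (elim x)
      have w: "1 / q l x * (1 / x) = weight x + ln x / sqrt (2 * x) * (1 / x)"
        using elim by (simp add: weight_def diff_divide_distrib)
      have k: "?c * (sqrt x / ln x ^ 2) * (ln x / sqrt (2 * x) * (1 / x)) = sqrt (real l) * (1 / (x * ln x))"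
        using elim by (simp add: real_sqrt_mult power2_eq_square)
      have regroup: "(a + k) * u + (a + k) * v - k * u = a * (u + v) + k * v" for a k u v :: real
        by (simp add: algebra_simps)
      have "(S_hat l x - li x) * (1 / q l x) * (1 / x) = (S_hat l x - li x) * (weight x + ln x / sqrt (2 * x) * (1 / x))"
        by (simp only: mult.assoc w)
      then show ?case unfolding regroup k by simp
    qed
  qed
qed

lemma bounded_integral_li_pi_weight: "bounded_integral (\<lambda>x. (li x - prime_pi x) * weight x)"
proof -
  define c where "c = sqrt (real l)"
  let ?d = "\<lambda>x. li x - prime_pi x"
  let ?u = "\<lambda>x. slope l x * osc x + bump l x * osc' x"
  let ?w = "\<lambda>x. weight x - c / 2 * (1 / x ^ 2) - ?u x"
  have "bounded_integral (\<lambda>x. c / 2 * (?d x / x ^ 2))"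
    by (rule bounded_integral_cmult[OF bounded_integral_li_pi_square])
  moreover have "bounded_integral (\<lambda>x. ?d x * ?u x)"
  proof (rule bounded_integral_li_pi_deriv)
    show "antideriv (\<lambda>x. bump l x * osc x) ?u"
      by (rule antideriv_mult[OF antideriv_bump[OF l] antideriv_osc])
    have "(\<lambda>x. bump l x * osc x) \<in> O(\<lambda>x. x * osc x)"
      by (intro landau_o.big.mult bump_bigo l landau_o.big_refl)
    also have "(\<lambda>x. x * osc x) \<in> O(\<lambda>x. x powr (-5/4))" unfolding osc_def by real_asymp
    finally show "(\<lambda>x. bump l x * osc x) \<in> O(\<lambda>x. x powr (-5/4))" .
  qed
  moreover have "bounded_integral (\<lambda>x. ?d x * ?w x)"
  proof (rule bounded_integral_bigo)
    have "locally_bounded (\<lambda>x. 1 / x ^ 2)"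
      by (intro locally_bounded_continuous continuous_intros) auto
    then show "(\<lambda>x. ?d x * ?w x) integrable_on {2..X}" for X
      by (intro locally_bounded_integrable locally_bounded_add locally_bounded_mult locally_bounded_diff
          locally_bounded_li locally_bounded_prime_pi locally_bounded_weight locally_bounded_slope
          locally_bounded_bump locally_bounded_osc locally_bounded_const)
    have "?d \<in> O(\<lambda>x. x)" by (intro sum_in_bigo li_bigo prime_pi_bigo)
    then have "(\<lambda>x. ?d x * ?w x) \<in> O(\<lambda>x. x * (ln x * x powr (- 5 / 2)))"
      unfolding c_def by (rule landau_o.big.mult[OF _ weight_remainder])
    also have "(\<lambda>x :: real. x * (ln x * x powr (- 5 / 2))) \<in> O(\<lambda>x. 1 / (x * ln x ^ 2))" by real_asymp
    finally show "(\<lambda>x. ?d x * ?w x) \<in> O(\<lambda>x. 1 / (x * ln x ^ 2))" .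
  qed
  ultimately have "bounded_integral (\<lambda>x. c / 2 * (?d x / x ^ 2) + ?d x * ?u x + ?d x * ?w x)"
    by (intro bounded_integral_add)
  then show ?thesis by (rule bounded_integral_cong) (simp add: algebra_simps)
qed

lemma integrable_Z: "(\<lambda>x. Z l x / x) integrable_on {2..X}"
proof -
  have "(\<lambda>x. (S_hat l x - prime_pi x) * (1 / q l x) * (1 / x)) integrable_on {2..X}"
    by (intro locally_bounded_integrable locally_bounded_mult locally_bounded_diff locally_bounded_S_hat
        locally_bounded_prime_pi locally_bounded_inverse_q locally_bounded_inverse)
  then show ?thesis by (simp add: Z_def)
qed

lemma bounded_integral_Z_E:
  "bounded_integral (\<lambda>x. Z l x / x - 1 / sqrt 2 * (E x / x) + sqrt (real l) * (1 / (x * ln x)))"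
  using bounded_integral_add[OF bounded_integral_S_hat_li bounded_integral_li_pi_weight]
proof (rule bounded_integral_cong)
  fix x :: real assume "x \<ge> 2"
  have "1 / sqrt 2 * (ln x / sqrt x * d) = ln x / sqrt (2 * x) * d" for d
    by (simp add: real_sqrt_mult)
  then have e: "1 / sqrt 2 * E x = ln x / sqrt (2 * x) * (li x - prime_pi x)" unfolding E_def .
  have z: "Z l x = (S_hat l x - prime_pi x) * (1 / q l x)" by (simp add: Z_def)
  have "1 / sqrt 2 * (E x / x) = ln x / sqrt (2 * x) * (li x - prime_pi x) / x"
    using e by simp
  then show "(S_hat l x - li x) * (1 / q l x) * (1 / x) + sqrt (real l) * (1 / (x * ln x)) + (li x - prime_pi x) * weight x
      = Z l x / x - 1 / sqrt 2 * (E x / x) + sqrt (real l) * (1 / (x * ln x))"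
    unfolding z weight_def by (simp only:) (simp add: algebra_simps diff_divide_distrib add_divide_distrib)
qed

lemma log_mean_difference:
  "(\<lambda>X. log_mean (Z l) X - (1 / sqrt 2 * log_mean E X
      - sqrt (real l) * ((ln (ln X) - ln (ln 2)) / ln (X / 2)))) \<in> O(\<lambda>X. 1 / ln X)"
proof -
  let ?f = "\<lambda>x. Z l x / x - 1 / sqrt 2 * (E x / x) + sqrt (real l) * (1 / (x * ln x))"
  have "(\<lambda>X. 1 / ln (X / 2) * integral {2..X} ?f) \<in> O(\<lambda>X. 1 / ln (X / 2) * 1)"
    using bounded_integral_Z_E unfolding bounded_integral_def
    by (intro landau_o.big.mult landau_o.big_refl) blast
  also have "(\<lambda>X :: real. 1 / ln (X / 2) * 1) \<in> O(\<lambda>X. 1 / ln X)" by real_asymp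
  finally show ?thesis
  proof (rule bigo_eventually_eq)
    show "eventually (\<lambda>X. 1 / ln (X / 2) * integral {2..X} ?f = log_mean (Z l) X - (1 / sqrt 2 * log_mean E X
      - sqrt (real l) * ((ln (ln X) - ln (ln 2)) / ln (X / 2)))) at_top"
      using eventually_ge_at_top[of 2]
    proof eventually_elim
      case (elim X)
      have "((\<lambda>x. 1 / (x * ln x)) has_integral (ln (ln X) - ln (ln 2))) {2..X}"
        using elim by (intro antideriv_has_integral antideriv_ln_ln) auto
      then have "(?f has_integral (integral {2..X} (\<lambda>x. Z l x / x) - 1 / sqrt 2 * integral {2..X} (\<lambda>x. E x / x)
          + sqrt (real l) * (ln (ln X) - ln (ln 2)))) {2..X}"
        by (intro has_integral_add has_integral_diff has_integral_mult_right integrable_integral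
            integrable_Z integrable_E)
      then have i: "integral {2..X} ?f = integral {2..X} (\<lambda>x. Z l x / x) - 1 / sqrt 2 * integral {2..X} (\<lambda>x. E x / x)
          + sqrt (real l) * (ln (ln X) - ln (ln 2))" by (rule integral_unique)
      show ?case unfolding i log_mean_def by (simp add: diff_divide_distrib add_divide_distrib algebra_simps)
    qed
  qed
qed

end

section \<open>From the error term to the limits\<close>

lemma bigo_tendsto_zero:
  fixes f g :: "'a \<Rightarrow> real"
  assumes "f \<in> O[F](g)" "(g \<longlongrightarrow> 0) F"
  shows "(f \<longlongrightarrow> 0) F"
proof -
  obtain c where "eventually (\<lambda>x. norm (f x) \<le> c * norm (g x)) F"
    using assms(1) by (elim landau_o.bigE)
  moreover have "((\<lambda>x. c * norm (g x)) \<longlongrightarrow> 0) F"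
    using tendsto_mult_left[OF tendsto_norm_zero[OF assms(2)], of c] by simp
  ultimately show ?thesis by (rule Lim_null_comparison)
qed

theorem theorem4p9:
  fixes l :: nat
  assumes "l \<ge> 1"
  shows "(\<lambda>X. log_mean (Z l) X -
            (1 / sqrt 2 * log_mean E X
             - sqrt (real l) * ((ln (ln X) - ln (ln 2)) / ln (X / 2))))
           \<in> O[at_top](\<lambda>X. 1 / ln X)
       \<and> (\<lambda>X. log_mean (Z l) X - 1 / sqrt 2 * log_mean E X)
           \<in> O[at_top](\<lambda>X. ln (ln X) / ln X)
       \<and> ((\<exists>c. (log_mean (Z l) \<longlongrightarrow> c) at_top) \<longleftrightarrow> (\<exists>c. (log_mean E \<longlongrightarrow> c) at_top))
       \<and> ((\<exists>c. (log_mean E \<longlongrightarrow> c) at_top) \<longrightarrow>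
            Lim at_top (log_mean (Z l)) = 1 / sqrt 2 * Lim at_top (log_mean E))"
proof -
  let ?d = "\<lambda>X. log_mean (Z l) X - 1 / sqrt 2 * log_mean E X"
  note main = log_mean_difference[OF assms]
  have "(\<lambda>X :: real. (ln (ln X) - ln (ln 2)) / ln (X / 2)) \<in> O(\<lambda>X. ln (ln X) / ln X)"
    by real_asymp
  then have "(\<lambda>X. sqrt (real l) * ((ln (ln X) - ln (ln 2)) / ln (X / 2))) \<in> O(\<lambda>X. ln (ln X) / ln X)"
    by (subst landau_o.big.cmult_in_iff) (use assms in auto)
  moreover have "(\<lambda>X :: real. 1 / ln X) \<in> O(\<lambda>X. ln (ln X) / ln X)" by real_asymp
  ultimately have d: "?d \<in> O(\<lambda>X. ln (ln X) / ln X)"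
    using sum_in_bigo(2)[OF landau_o.big_trans[OF main]] by fastforce
  moreover have "((\<lambda>X :: real. ln (ln X) / ln X) \<longlongrightarrow> 0) at_top" by real_asymp
  ultimately have d0: "(?d \<longlongrightarrow> 0) at_top"
    by (rule bigo_tendsto_zero)
  have ZE: "(log_mean (Z l) \<longlongrightarrow> 1 / sqrt 2 * c) at_top" if "(log_mean E \<longlongrightarrow> c) at_top" for c
    using tendsto_add[OF d0 tendsto_mult_left[OF that, of "1 / sqrt 2"]] by simp
  have EZ: "(log_mean E \<longlongrightarrow> sqrt 2 * c) at_top" if "(log_mean (Z l) \<longlongrightarrow> c) at_top" for c
    using tendsto_mult_left[OF tendsto_diff[OF that d0], of "sqrt 2"] by simp
  \<comment> \<open>\<open>Lim\<close> is a description operator, so its values on both sides are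
    identified from actual convergence.\<close>
  have "Lim at_top (log_mean (Z l)) = 1 / sqrt 2 * Lim at_top (log_mean E)" if "(log_mean E \<longlongrightarrow> c) at_top" for c
    using tendsto_Lim[OF _ that] tendsto_Lim[OF _ ZE[OF that]] by simp
  then show ?thesis using main d ZE EZ by blast
qed

end
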